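(* Let $\mathbf{k}$ be any field and let $n\ge 3$ be odd. Then the birational map $$\xi_n \colon [x_0:\dots:x_n]\dashrightarrow \left[x_0:x_1 :x_2\tfrac{x_1}{x_0}:x_3:\dots:x_n\right]$$ of $\mathbb{P}^n_{\mathbf{k}}$ does not belong to $G_n(\mathbf{k})$.
   Context: The standard involution is $\sigma_n\colon [x_0:\dots:x_n]\dashrightarrow [\frac{1}{x_0}:\dots:\frac{1}{x_n}]$, and $G_n(\mathbf{k})=\langle \sigma_n,\mathrm{Aut}(\mathbb{P}^n_{\mathbf{k}})\rangle$ is a subgroup of the group $\mathrm{Bir}(\mathbb{P}^n_{\mathbf{k}})$ of birational transformations of $\mathbb{P}^n_{\mathbf{k}}$. *)

theory Defs
  imports
    "HOL-Library.Poly_Mapping"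
    "HOL-Algebra.Generated_Groups"
    "HOL-Algebra.Algebraic_Closure_Type"
begin

section \<open>Polynomials and forms\<close>

text \<open>
  A polynomial over \<open>'a\<close> in the variables \<open>x\<^sub>0, x\<^sub>1, \<dots>\<close> is a finitely supported map from
  exponent vectors to coefficients; its multiplication is the convolution of Poly_Mapping.
\<close>

type_synonym 'a mpoly = "(nat \<Rightarrow>\<^sub>0 nat) \<Rightarrow>\<^sub>0 'a"

definition indet :: "nat \<Rightarrow> 'a::comm_ring_1 mpoly" where
  "indet i = Poly_Mapping.single (Poly_Mapping.single i 1) 1"

definition const_poly :: "'a::comm_ring_1 \<Rightarrow> 'a mpoly" where
  "const_poly a = Poly_Mapping.single 0 a"

definition eval_monom :: "(nat \<Rightarrow> 'b::comm_ring_1) \<Rightarrow> (nat \<Rightarrow>\<^sub>0 nat) \<Rightarrow> 'b" where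
  "eval_monom v m = (\<Prod>i\<in>Poly_Mapping.keys m. v i ^ Poly_Mapping.lookup m i)"

text \<open>Evaluation at \<open>v\<close>, after applying the ring homomorphism \<open>\<phi>\<close> to the coefficients.\<close>

definition eval_poly :: "('a::comm_ring_1 \<Rightarrow> 'b::comm_ring_1) \<Rightarrow> (nat \<Rightarrow> 'b) \<Rightarrow> 'a mpoly \<Rightarrow> 'b" where
  "eval_poly \<phi> v p =
     (\<Sum>m\<in>Poly_Mapping.keys p. \<phi> (Poly_Mapping.lookup p m) * eval_monom v m)"

text \<open>Homogeneous of degree \<open>d\<close> in \<open>x\<^sub>0, \<dots>, x\<^sub>n\<close>; the zero polynomial is a form of every degree.\<close>

definition is_form :: "nat \<Rightarrow> nat \<Rightarrow> 'a::comm_ring_1 mpoly \<Rightarrow> bool" where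
  "is_form n d p \<longleftrightarrow>
     (\<forall>m\<in>Poly_Mapping.keys p. Poly_Mapping.keys m \<subseteq> {..n} \<and>
        (\<Sum>i\<in>Poly_Mapping.keys m. Poly_Mapping.lookup m i) = d)"


section \<open>Rational self-maps of projective space\<close>

text \<open>
  A rational map \<open>[F\<^sub>0 : \<dots> : F\<^sub>n]\<close> is a tuple of forms of one common degree, not all zero, up to
  proportionality over the function field. Only the entries \<open>F i\<close> with \<open>i \<le> n\<close> are meaningful.
\<close>

definition form_tuple :: "nat \<Rightarrow> (nat \<Rightarrow> 'a::comm_ring_1 mpoly) \<Rightarrow> bool" where
  "form_tuple n F \<longleftrightarrow> (\<exists>d. \<forall>i\<le>n. is_form n d (F i)) \<and> (\<exists>i\<le>n. F i \<noteq> 0)"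

definition proportional :: "nat \<Rightarrow> ((nat \<Rightarrow> 'a::comm_ring_1 mpoly) \<times> (nat \<Rightarrow> 'a mpoly)) set" where
  "proportional n =
     {(F, G). form_tuple n F \<and> form_tuple n G \<and> (\<forall>i\<le>n. \<forall>j\<le>n. F i * G j = F j * G i)}"

type_synonym 'a rat_map = "(nat \<Rightarrow> 'a mpoly) set"

definition rat_maps :: "nat \<Rightarrow> 'a::comm_ring_1 rat_map set" where
  "rat_maps n = Collect (form_tuple n) // proportional n"

definition rat_class :: "nat \<Rightarrow> (nat \<Rightarrow> 'a::comm_ring_1 mpoly) \<Rightarrow> 'a rat_map" where
  "rat_class n F = proportional n `` {F}"

definition subst_tuple ::
    "(nat \<Rightarrow> 'a::comm_ring_1 mpoly) \<Rightarrow> (nat \<Rightarrow> 'a mpoly) \<Rightarrow> nat \<Rightarrow> 'a mpoly" where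
  "subst_tuple F G = (\<lambda>i. eval_poly const_poly G (F i))"

text \<open>
  Pairs of representatives whose composite vanishes identically contribute nothing to the union,
  because the zero tuple is not a \<open>form_tuple\<close>. The composite \<open>f \<circ> g\<close> is undefined (here: empty)
  only if this happens for all representatives.
\<close>

definition rat_comp :: "nat \<Rightarrow> 'a::comm_ring_1 rat_map \<Rightarrow> 'a rat_map \<Rightarrow> 'a rat_map" where
  "rat_comp n f g = (\<Union>F\<in>f. \<Union>G\<in>g. rat_class n (subst_tuple F G))"

definition Bir :: "nat \<Rightarrow> 'a::field rat_map monoid" where
  "Bir n = \<lparr>carrier = {f \<in> rat_maps n. \<exists>g\<in>rat_maps n.
                         rat_comp n f g = rat_class n indet \<and> rat_comp n g f = rat_class n indet},
            monoid.mult = rat_comp n,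
            one = rat_class n indet\<rparr>"


section \<open>Automorphisms of projective space\<close>

text \<open>
  Regularity is tested at all geometric points, that is at all points with coordinates in an
  algebraic closure of the ground field; the representatives have coefficients in the ground field.
\<close>

definition regular_at :: "nat \<Rightarrow> 'a::field rat_map \<Rightarrow> (nat \<Rightarrow> 'a alg_closure) \<Rightarrow> bool" where
  "regular_at n f p \<longleftrightarrow> (\<exists>F\<in>f. \<exists>i\<le>n. eval_poly to_ac p (F i) \<noteq> 0)"

definition is_morphism :: "nat \<Rightarrow> 'a::field rat_map \<Rightarrow> bool" where
  "is_morphism n f \<longleftrightarrow> (\<forall>p. (\<exists>i\<le>n. p i \<noteq> 0) \<longrightarrow> regular_at n f p)"

definition Aut_P :: "nat \<Rightarrow> 'a::field rat_map set" where
  "Aut_P n = {f \<in> carrier (Bir n). is_morphism n f \<and> is_morphism n (inv\<^bsub>Bir n\<^esub> f)}"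


section \<open>The standard involution, the group it generates with the automorphisms, and \<open>\<xi>\<^sub>n\<close>\<close>

text \<open>\<open>[1/x\<^sub>0 : \<dots> : 1/x\<^sub>n]\<close>, multiplied by \<open>x\<^sub>0 \<cdots> x\<^sub>n\<close>.\<close>

definition sigma_tuple :: "nat \<Rightarrow> nat \<Rightarrow> 'a::field mpoly" where
  "sigma_tuple n = (\<lambda>i. \<Prod>j\<in>{..n} - {i}. indet j)"

definition sigma :: "nat \<Rightarrow> 'a::field rat_map" where
  "sigma n = rat_class n (sigma_tuple n)"

definition G_grp :: "nat \<Rightarrow> 'a::field rat_map set" where
  "G_grp n = generate (Bir n) (insert (sigma n) (Aut_P n))"

text \<open>\<open>[x\<^sub>0 : x\<^sub>1 : x\<^sub>2 (x\<^sub>1/x\<^sub>0) : x\<^sub>3 : \<dots> : x\<^sub>n]\<close>, multiplied by \<open>x\<^sub>0\<close>.\<close>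

definition xi_tuple :: "nat \<Rightarrow> 'a::field mpoly" where
  "xi_tuple = (\<lambda>i. if i = 2 then indet 2 * indet 1 else indet 0 * indet i)"

definition xi :: "nat \<Rightarrow> 'a::field rat_map" where
  "xi n = rat_class n xi_tuple"


section \<open>\<open>Bir n\<close> is a group containing \<open>\<sigma>\<^sub>n\<close> and \<open>\<xi>\<^sub>n\<close>\<close>

text \<open>
  The facts below only justify the definitions above: composition of birational classes is
  computed on arbitrary representatives, \<open>Bir n\<close> is a group (so that \<open>inv\<close> and \<open>generate\<close> have
  their usual meaning), and the two explicit maps are birational.
\<close>

lemma mpoly_induct [case_names zero add]:
  fixes p :: "'b \<Rightarrow>\<^sub>0 'a::comm_ring_1"
  assumes "P 0" and "\<And>m c p. P p \<Longrightarrow> P (Poly_Mapping.single m c + p)"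
  shows "P p"
proof (induction p rule: Poly_Mapping.update_induct)
  case const then show ?case by (rule assms)
next
  case (update f a b)
  have "Poly_Mapping.update a b f = Poly_Mapping.single a b + f"
    by (rule poly_mapping_eqI) (use update in \<open>auto simp: lookup_update lookup_add lookup_single when_def in_keys_iff\<close>)
  then show ?case using assms(2) update by simp
qed

locale ring_map =
  fixes \<phi> :: "'a::comm_ring_1 \<Rightarrow> 'b::comm_ring_1"
  assumes add [simp]: "\<phi> (x + y) = \<phi> x + \<phi> y"
    and mult [simp]: "\<phi> (x * y) = \<phi> x * \<phi> y"
    and one [simp]: "\<phi> 1 = 1"
begin
lemma zero [simp]: "\<phi> 0 = 0"
  using add[of 0 0] by simp
end

lemma eval_monom_superset:
  assumes "finite A" "Poly_Mapping.keys m \<subseteq> A"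
  shows "eval_monom v m = (\<Prod>i\<in>A. v i ^ Poly_Mapping.lookup m i)"
  unfolding eval_monom_def
  by (rule prod.mono_neutral_left) (use assms in \<open>auto simp: in_keys_iff\<close>)

lemma eval_monom_add: "eval_monom v (m + m') = eval_monom v m * eval_monom v m'"
proof -
  let ?A = "Poly_Mapping.keys m \<union> Poly_Mapping.keys m'"
  show ?thesis
    using keys_add[of m m']
    by (subst (1 2 3) eval_monom_superset[of ?A])
       (auto simp: lookup_add power_add prod.distrib)
qed

lemma eval_monom_zero [simp]: "eval_monom v 0 = 1"
  by (simp add: eval_monom_def)

context ring_map begin

lemma eval_superset:
  assumes "finite A" "Poly_Mapping.keys p \<subseteq> A"
  shows "eval_poly \<phi> v p = (\<Sum>m\<in>A. \<phi> (Poly_Mapping.lookup p m) * eval_monom v m)"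
  unfolding eval_poly_def
  by (rule sum.mono_neutral_left) (use assms in \<open>auto simp: in_keys_iff\<close>)

lemma eval_zero [simp]: "eval_poly \<phi> v 0 = 0" by (simp add: eval_poly_def)

lemma eval_single [simp]: "eval_poly \<phi> v (Poly_Mapping.single m c) = \<phi> c * eval_monom v m"
  by (subst eval_superset[of "{m}"]) auto

lemma eval_add [simp]: "eval_poly \<phi> v (p + q) = eval_poly \<phi> v p + eval_poly \<phi> v q"
proof -
  let ?A = "Poly_Mapping.keys p \<union> Poly_Mapping.keys q"
  show ?thesis
    using keys_add[of p q]
    by (subst (1 2 3) eval_superset[of ?A])
       (auto simp: lookup_add algebra_simps sum.distrib)
qed

lemma eval_single_mult:
  "eval_poly \<phi> v (Poly_Mapping.single m c * q) = \<phi> c * eval_monom v m * eval_poly \<phi> v q"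
  by (induction q rule: mpoly_induct)
     (auto simp: algebra_simps mult_single eval_monom_add)

lemma eval_mult [simp]: "eval_poly \<phi> v (p * q) = eval_poly \<phi> v p * eval_poly \<phi> v q"
  by (induction p rule: mpoly_induct) (auto simp: eval_single_mult distrib_right mult.assoc)

lemma eval_one [simp]: "eval_poly \<phi> v 1 = 1"
  using eval_single[of v 0 1] by simp

lemma eval_power [simp]: "eval_poly \<phi> v (p ^ k) = eval_poly \<phi> v p ^ k"
  by (induction k) auto

lemma eval_prod [simp]: "eval_poly \<phi> v (prod f A) = (\<Prod>i\<in>A. eval_poly \<phi> v (f i))"
  by (induction A rule: infinite_finite_induct) auto

lemma eval_indet [simp]: "eval_poly \<phi> v (indet i) = v i"
  by (simp add: indet_def eval_monom_def)

end

interpretation const: ring_map const_poly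
  by standard (auto simp: const_poly_def single_add mult_single)

abbreviation poly_subst where "poly_subst \<equiv> eval_poly const_poly"

lemma sub_const [simp]: "poly_subst v (const_poly c) = const_poly c"
  unfolding const_poly_def[of c] const.eval_single by (simp add: const_poly_def)

lemma eval_monom_sub: "poly_subst G (eval_monom F m) = eval_monom (\<lambda>i. poly_subst G (F i)) m"
  by (simp add: eval_monom_def)

lemma sub_sub: "poly_subst G (poly_subst F p) = poly_subst (\<lambda>i. poly_subst G (F i)) p"
  by (induction p rule: mpoly_induct) (auto simp: eval_monom_sub)

lemma single_indet: "Poly_Mapping.single m c = const_poly c * eval_monom indet m"
proof -
  have "eval_monom indet m = Poly_Mapping.single m (1::'a)"
  proof (induction m rule: Poly_Mapping.update_induct)
    case (update f a b)
    have u: "Poly_Mapping.update a b f = Poly_Mapping.single a b + f"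
      by (rule poly_mapping_eqI) (use update in \<open>auto simp: lookup_update lookup_add lookup_single when_def in_keys_iff\<close>)
    have s: "indet a ^ b = (Poly_Mapping.single (Poly_Mapping.single a b) 1 :: 'a mpoly)"
    proof (induction b)
      case (Suc b)
      then show ?case by (simp add: indet_def mult_single flip: single_add)
    qed simp
    have "eval_monom indet (Poly_Mapping.single a b) = (Poly_Mapping.single (Poly_Mapping.single a b) 1 :: 'a mpoly)"
      by (cases "b = 0") (auto simp: eval_monom_def s)
    with update show ?case by (simp add: u eval_monom_add mult_single)
  qed simp
  then show ?thesis by (simp add: const_poly_def mult_single)
qed

lemma sub_indet [simp]: "poly_subst indet p = p"
  by (induction p rule: mpoly_induct) (auto simp: single_indet eval_monom_sub)

lemma is_form_deg: "is_form n d p \<longleftrightarrow> (\<forall>m\<in>Poly_Mapping.keys p. Poly_Mapping.keys m \<subseteq> {..n} \<and>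
        (\<Sum>i\<le>n. Poly_Mapping.lookup m i) = d)"
proof -
  have "(\<Sum>i\<in>Poly_Mapping.keys m. Poly_Mapping.lookup m i) = (\<Sum>i\<le>n. Poly_Mapping.lookup m i)"
    if "Poly_Mapping.keys m \<subseteq> {..n}" for m
    by (rule sum.mono_neutral_left) (use that in \<open>auto simp: in_keys_iff\<close>)
  then show ?thesis unfolding is_form_def by (metis (no_types, lifting))
qed

lemma form_add: "is_form n d p \<Longrightarrow> is_form n d q \<Longrightarrow> is_form n d (p + q)"
  using keys_add[of p q] unfolding is_form_def by blast

lemma form_mult:
  assumes "is_form n d p" "is_form n e q" shows "is_form n (d + e) (p * q)"
  unfolding is_form_deg
proof
  fix m assume "m \<in> Poly_Mapping.keys (p * q)"
  then obtain a b where ab: "a \<in> Poly_Mapping.keys p" "b \<in> Poly_Mapping.keys q" "m = a + b"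
    using keys_mult[of p q] by blast
  then show "Poly_Mapping.keys m \<subseteq> {..n} \<and> (\<Sum>i\<le>n. Poly_Mapping.lookup m i) = d + e"
    using assms keys_add[of a b] unfolding is_form_deg
    by (force simp: lookup_add sum.distrib)
qed

lemma form_zero [simp]: "is_form n d 0" by (simp add: is_form_def)
lemma form_one [simp]: "is_form n 0 1" by (simp add: is_form_def)
lemma form_const [simp]: "is_form n 0 (const_poly c)" by (auto simp: is_form_def const_poly_def)
lemma form_indet [simp]: "i \<le> n \<Longrightarrow> is_form n 1 (indet i)" by (auto simp: is_form_def indet_def)

lemma form_power: "is_form n d p \<Longrightarrow> is_form n (k * d) (p ^ k)"
  by (induction k) (auto intro: form_mult)

lemma form_prod:
  "(\<And>i. i \<in> A \<Longrightarrow> is_form n (d i) (f i)) \<Longrightarrow> is_form n (\<Sum>i\<in>A. d i) (\<Prod>i\<in>A. f i)"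
  by (induction A rule: infinite_finite_induct) (auto intro: form_mult)

lemma form_sum:
  "(\<And>i. i \<in> A \<Longrightarrow> is_form n d (f i)) \<Longrightarrow> is_form n d (\<Sum>i\<in>A. f i)"
  by (induction A rule: infinite_finite_induct) (auto intro: form_add)

lemma form_sub:
  assumes p: "is_form n d p" and G: "\<And>i. i \<le> n \<Longrightarrow> is_form n e (G i)"
  shows "is_form n (d * e) (poly_subst G p)"
  unfolding eval_poly_def
proof (rule form_sum)
  fix m assume m: "m \<in> Poly_Mapping.keys p"
  have "is_form n (\<Sum>i\<in>Poly_Mapping.keys m. Poly_Mapping.lookup m i * e) (eval_monom G m)"
    unfolding eval_monom_def
    using p m by (intro form_prod form_power G) (auto simp: is_form_def)
  then have "is_form n (d * e) (eval_monom G m)"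
    using p m by (simp add: is_form_def flip: sum_distrib_right)
  then show "is_form n (d * e) (const_poly (Poly_Mapping.lookup p m) * eval_monom G m)"
    using form_mult[OF form_const] by fastforce
qed

lemma sub_cong:
  assumes p: "is_form n d p" and G: "\<And>i. i \<le> n \<Longrightarrow> G i = H i"
  shows "poly_subst G p = poly_subst H p"
  unfolding eval_poly_def eval_monom_def
  using p G by (intro sum.cong prod.cong arg_cong2[where f = "(*)"] arg_cong2[where f = "(^)"]) (auto simp: is_form_def)

lemma sub_scale:
  assumes p: "is_form n d p"
  shows "poly_subst (\<lambda>i. h * G i) p = h ^ d * poly_subst G p"
proof -
  have "eval_monom (\<lambda>i. h * G i) m = h ^ d * eval_monom G m" if "m \<in> Poly_Mapping.keys p" for m
    using p that unfolding eval_monom_def is_form_def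
    by (auto simp: power_mult_distrib prod.distrib simp flip: power_sum)
  then show ?thesis
    unfolding eval_poly_def sum_distrib_left by (intro sum.cong) (auto simp: algebra_simps)
qed


lemma proportional_equiv:
  "equiv (Collect (form_tuple n)) (proportional n :: ((nat \<Rightarrow> 'a::field mpoly) \<times> _) set)"
proof (rule equivI)
  show "refl_on (Collect (form_tuple n)) (proportional n)"
    by (auto simp: refl_on_def proportional_def)
  show "(proportional n :: ((nat \<Rightarrow> 'a mpoly) \<times> _) set) \<subseteq> Collect (form_tuple n) \<times> Collect (form_tuple n)"
    by (auto simp: proportional_def)
  show "sym (proportional n :: ((nat \<Rightarrow> 'a mpoly) \<times> _) set)"
    by (auto simp: sym_def proportional_def mult.commute)
  show "trans (proportional n :: ((nat \<Rightarrow> 'a mpoly) \<times> _) set)"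
  proof (rule transI)
    fix F G H :: "nat \<Rightarrow> 'a mpoly"
    assume FG: "(F, G) \<in> proportional n" and GH: "(G, H) \<in> proportional n"
    obtain k where k: "k \<le> n" "G k \<noteq> 0" using FG by (auto simp: proportional_def form_tuple_def)
    have "F i * H j = F j * H i" if "i \<le> n" "j \<le> n" for i j
    proof -
      have "G k * (F i * H j) = (F i * G k) * H j" by simp
      also have "\<dots> = F k * (G i * H j)" using FG that k by (simp add: proportional_def mult.assoc)
      also have "\<dots> = F k * (G j * H i)" using GH that k by (simp add: proportional_def)
      also have "\<dots> = (F k * G j) * H i" by simp
      also have "\<dots> = G k * (F j * H i)" using FG that k by (simp add: proportional_def)
      finally show ?thesis using k by simp
    qed
    then show "(F, H) \<in> proportional n" using FG GH by (auto simp: proportional_def)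
  qed
qed

lemma rat_class_eq: "form_tuple n F \<Longrightarrow> form_tuple n G \<Longrightarrow>
    rat_class n F = rat_class n (G :: nat \<Rightarrow> 'a::field mpoly) \<longleftrightarrow> (F, G) \<in> proportional n"
  unfolding rat_class_def using eq_equiv_class_iff[OF proportional_equiv] by blast

lemma rat_class_eqI: "(F, G) \<in> proportional n \<Longrightarrow> rat_class n F = rat_class n (G :: nat \<Rightarrow> 'a::field mpoly)"
  by (subst rat_class_eq) (auto simp: proportional_def)

lemma in_rat_class: "F \<in> rat_class n G \<longleftrightarrow> (G, F) \<in> proportional n"
  by (simp add: rat_class_def)

lemma rat_class_self: "form_tuple n F \<Longrightarrow> F \<in> rat_class n (F :: nat \<Rightarrow> 'a::field mpoly)"
  by (simp add: in_rat_class proportional_def)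

lemma rat_mapsE:
  assumes "f \<in> rat_maps n" "F \<in> (f :: 'a::field rat_map)"
  shows "f = rat_class n F" "form_tuple n F"
proof -
  obtain F' where F': "form_tuple n F'" "f = rat_class n F'"
    using assms(1) by (auto simp: rat_maps_def rat_class_def elim!: quotientE)
  then have "(F', F) \<in> proportional n" using assms(2) by (simp add: in_rat_class)
  then show "f = rat_class n F" "form_tuple n F"
    using rat_class_eqI F' by (auto simp: proportional_def)
qed

lemma rat_class_in: "form_tuple n F \<Longrightarrow> rat_class n F \<in> rat_maps n"
  by (auto simp: rat_maps_def rat_class_def intro: quotientI)

lemma rat_maps_nonempty: "f \<in> rat_maps n \<Longrightarrow> \<exists>F. (F :: nat \<Rightarrow> 'a::field mpoly) \<in> f"
  using rat_class_self by (auto simp: rat_maps_def rat_class_def elim!: quotientE)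

lemma rat_class_empty: "\<not> form_tuple n F \<Longrightarrow> rat_class n F = {}"
  by (auto simp: rat_class_def proportional_def)

abbreviation forms_of_degree where "forms_of_degree n F d \<equiv> \<forall>i\<le>n. is_form n d (F i)"

lemma subst_tuple_form:
  assumes "form_tuple n F" "form_tuple n G" "\<exists>i\<le>n. subst_tuple F G i \<noteq> 0"
  shows "form_tuple n (subst_tuple F G)"
  using assms unfolding form_tuple_def subst_tuple_def by (blast intro: form_sub)

lemma proportional_sub:
  assumes FG: "(F, G) \<in> proportional n" and p: "is_form n d p" and i: "i \<le> n"
  shows "F i ^ d * poly_subst G p = G i ^ d * poly_subst F p"
proof -
  have "F i ^ d * poly_subst G p = poly_subst (\<lambda>j. F i * G j) p" by (simp add: sub_scale[OF p])
  also have "\<dots> = poly_subst (\<lambda>j. G i * F j) p"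
    using FG i by (intro sub_cong[OF p]) (auto simp: proportional_def mult.commute)
  also have "\<dots> = G i ^ d * poly_subst F p" by (simp add: sub_scale[OF p])
  finally show ?thesis .
qed

lemma subst_proportional:
  fixes F F' G G' :: "nat \<Rightarrow> 'a::field mpoly"
  assumes FF: "(F, F') \<in> proportional n" and GG: "(G, G') \<in> proportional n"
    and i: "i \<le> n" and j: "j \<le> n"
  shows "subst_tuple F G i * subst_tuple F' G' j = subst_tuple F G j * subst_tuple F' G' i"
proof -
  obtain k where k: "k \<le> n" "G k \<noteq> 0" using GG by (auto simp: proportional_def form_tuple_def)
  obtain e where e: "forms_of_degree n F' e" using FF by (auto simp: proportional_def form_tuple_def)
  have *: "poly_subst G (F i) * poly_subst G (F' j) = poly_subst G (F j) * poly_subst G (F' i)"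
    using FF i j by (simp add: proportional_def flip: const.eval_mult)
  have "G k ^ e * (poly_subst G (F i) * poly_subst G' (F' j)) = poly_subst G (F i) * (G k ^ e * poly_subst G' (F' j))" by simp
  also have "\<dots> = poly_subst G (F i) * (G' k ^ e * poly_subst G (F' j))" 
    using proportional_sub[OF GG _ k(1), of e "F' j"] e j by simp
  also have "\<dots> = G' k ^ e * (poly_subst G (F i) * poly_subst G (F' j))" by simp
  also have "\<dots> = poly_subst G (F j) * (G' k ^ e * poly_subst G (F' i))" using * by simp
  also have "\<dots> = poly_subst G (F j) * (G k ^ e * poly_subst G' (F' i))" 
    using proportional_sub[OF GG _ k(1), of e "F' i"] e i by simp
  also have "\<dots> = G k ^ e * (poly_subst G (F j) * poly_subst G' (F' i))" by simp
  finally show ?thesis using k by (simp add: subst_tuple_def)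
qed

lemma rat_comp_class:
  fixes F G :: "nat \<Rightarrow> 'a::field mpoly"
  assumes F: "form_tuple n F" and G: "form_tuple n G" and FG: "\<exists>i\<le>n. subst_tuple F G i \<noteq> 0"
  shows "rat_comp n (rat_class n F) (rat_class n G) = rat_class n (subst_tuple F G)"
proof -
  have "rat_class n (subst_tuple F' G') \<subseteq> rat_class n (subst_tuple F G)"
    if "F' \<in> rat_class n F" "G' \<in> rat_class n G" for F' G'
  proof (cases "form_tuple n (subst_tuple F' G')")
    case True
    have "(subst_tuple F G, subst_tuple F' G') \<in> proportional n"
      using True subst_tuple_form[OF F G FG] subst_proportional[OF that[unfolded in_rat_class]]
      by (simp add: proportional_def)
    then show ?thesis by (simp add: rat_class_eqI)
  qed (simp add: rat_class_empty)
  then show ?thesis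
    unfolding rat_comp_def using rat_class_self[OF F] rat_class_self[OF G] by blast
qed

lemma rat_compE:
  fixes f g :: "'a::field rat_map"
  assumes "f \<in> rat_maps n" "g \<in> rat_maps n" "rat_comp n f g \<in> rat_maps n"
  obtains F G where "form_tuple n F" "form_tuple n G" "f = rat_class n F" "g = rat_class n G"
    "\<exists>i\<le>n. subst_tuple F G i \<noteq> 0" "rat_comp n f g = rat_class n (subst_tuple F G)"
proof -
  obtain H where "H \<in> rat_comp n f g" using rat_maps_nonempty assms by blast
  then obtain F G where FG: "F \<in> f" "G \<in> g" "H \<in> rat_class n (subst_tuple F G)"
    by (auto simp: rat_comp_def)
  have nz: "\<exists>i\<le>n. subst_tuple F G i \<noteq> 0"
    using FG(3) by (auto simp: in_rat_class proportional_def form_tuple_def)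
  note F = rat_mapsE[OF assms(1) FG(1)] and G = rat_mapsE[OF assms(2) FG(2)]
  show thesis
    using that[OF F(2) G(2) F(1) G(1) nz] rat_comp_class[OF F(2) G(2) nz] F G by simp
qed

definition dominant :: "nat \<Rightarrow> (nat \<Rightarrow> 'a::field mpoly) \<Rightarrow> bool" where
  "dominant n F \<longleftrightarrow> form_tuple n F \<and> (\<forall>d p. is_form n d p \<longrightarrow> poly_subst F p = 0 \<longrightarrow> p = 0)"

lemma indet_nonzero [simp]: "indet i \<noteq> (0 :: 'a::field mpoly)"
  unfolding indet_def by (metis lookup_single_eq lookup_zero one_neq_zero)

lemma form_tuple_indet [simp]: "form_tuple n (indet :: nat \<Rightarrow> 'a::field mpoly)"
  unfolding form_tuple_def using form_indet indet_nonzero by blast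

lemma dominantI:
  assumes F: "form_tuple n F" and id: "(subst_tuple F G, indet) \<in> proportional n"
  shows "dominant n F"
  unfolding dominant_def
proof (intro conjI allI impI F)
  fix d p assume p: "is_form n d p" "poly_subst F p = 0"
  obtain k where k: "k \<le> n" "subst_tuple F G k \<noteq> 0"
    using id by (auto simp: proportional_def form_tuple_def)
  have "poly_subst (subst_tuple F G) p = 0"
    using p(2) unfolding subst_tuple_def by (simp flip: sub_sub)
  then show "p = 0" using proportional_sub[OF id p(1) k(1)] k(2) by simp
qed

lemma dominant_subst:
  assumes F: "dominant n F" and G: "dominant n G"
  shows "\<exists>i\<le>n. subst_tuple F G i \<noteq> 0" "dominant n (subst_tuple F G)"
proof -
  have FT: "form_tuple n F" "form_tuple n G" using F G by (auto simp: dominant_def)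
  then obtain d where d: "forms_of_degree n F d" by (auto simp: form_tuple_def)
  show nz: "\<exists>i\<le>n. subst_tuple F G i \<noteq> 0"
    using FT(1) d G unfolding form_tuple_def subst_tuple_def dominant_def by blast
  have "p = 0" if p: "is_form n e p" "poly_subst (subst_tuple F G) p = 0" for e p
  proof -
    have "poly_subst G (poly_subst F p) = 0" using p(2) by (simp add: sub_sub subst_tuple_def)
    moreover have "is_form n (e * d) (poly_subst F p)" using form_sub[OF p(1)] d by simp
    ultimately have "poly_subst F p = 0" using G by (auto simp: dominant_def)
    then show "p = 0" using F p by (auto simp: dominant_def)
  qed
  then show "dominant n (subst_tuple F G)"
    using subst_tuple_form[OF FT nz] by (auto simp: dominant_def)
qed

lemma subst_tuple_assoc: "subst_tuple (subst_tuple F G) H = subst_tuple F (subst_tuple G H)"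
  by (simp add: subst_tuple_def sub_sub)

lemma subst_tuple_indet [simp]: "subst_tuple F indet = F" "subst_tuple indet F = F"
  by (auto simp: subst_tuple_def)

lemma dominant_indet: "dominant n indet"
  by (simp add: dominant_def)

lemma comp_dominant:
  "dominant n F \<Longrightarrow> dominant n G \<Longrightarrow>
     rat_comp n (rat_class n F) (rat_class n G) = rat_class n (subst_tuple F G)"
  by (rule rat_comp_class) (use dominant_subst(1) in \<open>auto simp: dominant_def\<close>)

lemma BirE:
  assumes "f \<in> carrier (Bir n)"
  obtains F where "dominant n F" "f = rat_class n F"
proof -
  obtain g where g: "f \<in> rat_maps n" "g \<in> rat_maps n" "rat_comp n f g = rat_class n indet"
    using assms by (auto simp: Bir_def)
  then obtain F G where FG: "form_tuple n F" "form_tuple n G" "f = rat_class n F" "g = rat_class n G"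
    "\<exists>i\<le>n. subst_tuple F G i \<noteq> 0" "rat_comp n f g = rat_class n (subst_tuple F G)"
    by (metis rat_compE rat_class_in form_tuple_indet)
  have "(subst_tuple F G, indet) \<in> proportional n"
    using FG g subst_tuple_form by (metis rat_class_eq form_tuple_indet)
  then show thesis using that dominantI FG by blast
qed

lemma BirI:
  assumes "form_tuple n F" "form_tuple n G"
    "(subst_tuple F G, indet) \<in> proportional n" "(subst_tuple G F, indet) \<in> proportional n"
  shows "rat_class n F \<in> carrier (Bir n)"
proof -
  have "dominant n F" "dominant n G" using assms dominantI by blast+
  then have "rat_comp n (rat_class n F) (rat_class n G) = rat_class n indet"
    "rat_comp n (rat_class n G) (rat_class n F) = rat_class n indet"
    using assms rat_class_eqI by (auto simp: comp_dominant)
  then show ?thesis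
    using assms rat_class_in by (auto simp: Bir_def)
qed

lemma Bir_inverse:
  assumes "f \<in> carrier (Bir n)"
  obtains g where "g \<in> carrier (Bir n)" "rat_comp n f g = rat_class n indet"
    "rat_comp n g f = rat_class n indet"
  using assms by (auto simp: Bir_def)

lemma Bir_assoc:
  assumes "f \<in> carrier (Bir n)" "g \<in> carrier (Bir n)" "h \<in> carrier (Bir n)"
  shows "rat_comp n (rat_comp n f g) h = rat_comp n f (rat_comp n g h)"
proof -
  obtain F G H where "dominant n F" "f = rat_class n F" "dominant n G" "g = rat_class n G"
    "dominant n H" "h = rat_class n H" using assms BirE by metis
  then show ?thesis by (simp add: comp_dominant dominant_subst subst_tuple_assoc)
qed

lemma Bir_id:
  assumes "f \<in> carrier (Bir n)"
  shows "rat_comp n f (rat_class n indet) = f" "rat_comp n (rat_class n indet) f = f"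
  using assms by (auto elim!: BirE simp: comp_dominant dominant_indet)

lemma Bir_comp_rat_maps:
  assumes "f \<in> carrier (Bir n)" "g \<in> carrier (Bir n)"
  shows "rat_comp n f g \<in> rat_maps n"
proof -
  obtain F G where "dominant n F" "f = rat_class n F" "dominant n G" "g = rat_class n G"
    using assms BirE by metis
  then show ?thesis
    using rat_class_in dominant_subst(2) by (metis comp_dominant dominant_def)
qed

lemma Bir_one: "rat_class n indet \<in> carrier (Bir n)"
  by (rule BirI[of _ _ indet]) (auto simp: proportional_def)

theorem Bir_group: "group (Bir n)"
proof (rule groupI)
  fix f g :: "'a rat_map" assume f: "f \<in> carrier (Bir n)" and g: "g \<in> carrier (Bir n)"
  obtain f' where f': "f' \<in> carrier (Bir n)" "rat_comp n f f' = rat_class n indet"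
    "rat_comp n f' f = rat_class n indet" using f Bir_inverse by blast
  obtain g' where g': "g' \<in> carrier (Bir n)" "rat_comp n g g' = rat_class n indet"
    "rat_comp n g' g = rat_class n indet" using g Bir_inverse by blast
  obtain F G F' G' where r: "dominant n F" "f = rat_class n F" "dominant n G" "g = rat_class n G"
    "dominant n F'" "f' = rat_class n F'" "dominant n G'" "g' = rat_class n G'"
    using f g f' g' BirE by metis
  have "rat_comp n (rat_comp n f g) (rat_comp n g' f') = rat_comp n (rat_comp n f (rat_comp n g g')) f'"
    using r by (simp add: comp_dominant dominant_subst subst_tuple_assoc)
  also have "\<dots> = rat_class n indet" using f g' f' by (simp add: Bir_id)
  finally have 1: "rat_comp n (rat_comp n f g) (rat_comp n g' f') = rat_class n indet" .
  have "rat_comp n (rat_comp n g' f') (rat_comp n f g) = rat_comp n (rat_comp n g' (rat_comp n f' f)) g"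
    using r by (simp add: comp_dominant dominant_subst subst_tuple_assoc)
  also have "\<dots> = rat_class n indet" using f g' f' by (simp add: Bir_id)
  finally show "f \<otimes>\<^bsub>Bir n\<^esub> g \<in> carrier (Bir n)"
    using 1 Bir_comp_rat_maps[OF f g] Bir_comp_rat_maps[OF g'(1) f'(1)] by (auto simp: Bir_def)
next
  show "\<one>\<^bsub>Bir n\<^esub> \<in> carrier (Bir n)" using Bir_one by (simp add: Bir_def)
next
  fix f g h :: "'a rat_map"
  assume "f \<in> carrier (Bir n)" "g \<in> carrier (Bir n)" "h \<in> carrier (Bir n)"
  then show "f \<otimes>\<^bsub>Bir n\<^esub> g \<otimes>\<^bsub>Bir n\<^esub> h = f \<otimes>\<^bsub>Bir n\<^esub> (g \<otimes>\<^bsub>Bir n\<^esub> h)"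
    using Bir_assoc by (simp add: Bir_def)
next
  fix f :: "'a rat_map" assume f: "f \<in> carrier (Bir n)"
  then show "\<one>\<^bsub>Bir n\<^esub> \<otimes>\<^bsub>Bir n\<^esub> f = f" using Bir_id by (simp add: Bir_def)
  show "\<exists>y\<in>carrier (Bir n). y \<otimes>\<^bsub>Bir n\<^esub> f = \<one>\<^bsub>Bir n\<^esub>"
    using f by (auto simp: Bir_def)
qed

lemma sigma_tuple_form: "form_tuple n (sigma_tuple n)"
proof -
  have "is_form n n (\<Prod>j\<in>{..n} - {i}. indet j :: 'a mpoly)" if "i \<le> n" for i
  proof -
    have "is_form n (\<Sum>j\<in>{..n} - {i}. 1) (\<Prod>j\<in>{..n} - {i}. indet j :: 'a mpoly)"
      by (rule form_prod) (auto intro: form_indet simp del: One_nat_def)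
    then show ?thesis using that by simp
  qed
  then show ?thesis unfolding form_tuple_def sigma_tuple_def by (fastforce simp: prod_zero_iff)
qed

lemma sigma_tuple_mult: "i \<le> n \<Longrightarrow> sigma_tuple n i * indet i = (\<Prod>j\<le>n. indet j)"
  unfolding sigma_tuple_def by (subst (2) prod.remove[of _ i]) (auto simp: mult.commute)

theorem sigma_in_Bir: "sigma n \<in> carrier (Bir n)"
proof -
  let ?s = "sigma_tuple n :: nat \<Rightarrow> 'a mpoly"
  let ?ss = "subst_tuple ?s ?s"
  have nz: "?s i \<noteq> 0" if "i \<le> n" for i by (simp add: sigma_tuple_def prod_zero_iff)
  have ss: "?ss i = (\<Prod>j\<in>{..n} - {i}. ?s j)" for i
    by (simp add: subst_tuple_def sigma_tuple_def[of n, THEN fun_cong])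
  have m: "?ss i * ?s i = (\<Prod>j\<le>n. ?s j)" if "i \<le> n" for i
    unfolding ss using that by (subst (2) prod.remove[of _ i]) (auto simp: mult.commute)
  have ft: "form_tuple n ?ss"
    by (rule subst_tuple_form[OF sigma_tuple_form sigma_tuple_form])
       (auto simp: ss prod_zero_iff nz intro!: exI[of _ 0])
  have "?ss i * indet j = ?ss j * indet i" if ij: "i \<le> n" "j \<le> n" for i j
  proof -
    have "(?ss i * indet j) * (?s i * ?s j) = (?ss i * ?s i) * (?s j * indet j)" by simp
    also have "\<dots> = (?ss j * ?s j) * (?s i * indet i)" using ij by (simp add: m sigma_tuple_mult)
    also have "\<dots> = (?ss j * indet i) * (?s i * ?s j)" by simp
    finally show ?thesis using nz ij by simp
  qed
  then show ?thesis
    unfolding sigma_def using ft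
    by (intro BirI[OF sigma_tuple_form sigma_tuple_form]) (auto simp: proportional_def)
qed

theorem G_grp_subgroup: "subgroup (G_grp n) (Bir n)"
  unfolding G_grp_def
  by (rule group.generate_is_subgroup[OF Bir_group]) (use sigma_in_Bir in \<open>auto simp: Aut_P_def\<close>)

theorem xi_in_Bir:
  assumes n: "n \<ge> 2" shows "xi n \<in> carrier (Bir n)"
proof -
  let ?y = "\<lambda>i. if i = 2 then indet 2 * indet 0 else indet 1 * indet i :: 'a mpoly"
  let ?x = "xi_tuple :: nat \<Rightarrow> 'a mpoly"
  have f2: "is_form n 2 (indet i * indet j :: 'a mpoly)" if "i \<le> n" "j \<le> n" for i j
    using form_mult[OF form_indet form_indet, of i n j] that by (simp add: numeral_2_eq_2)
  have x: "form_tuple n ?x" unfolding form_tuple_def xi_tuple_def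
    using n by (intro conjI exI[of _ 2] exI[of _ 0]) (auto intro: f2)
  have y: "form_tuple n ?y" unfolding form_tuple_def
    using n by (intro conjI exI[of _ 2] exI[of _ 0]) (auto intro: f2)
  have xy: "subst_tuple ?x ?y i = indet 0 * indet 1 * indet 1 * indet i" for i
    by (simp add: subst_tuple_def xi_tuple_def algebra_simps)
  have yx: "subst_tuple ?y ?x i = indet 0 * indet 0 * indet 1 * indet i" for i
    by (simp add: subst_tuple_def xi_tuple_def algebra_simps)
  show ?thesis unfolding xi_def
    using subst_tuple_form[OF x y] subst_tuple_form[OF y x]
    by (intro BirI[OF x y]) (auto simp: proportional_def xy yx)
qed


end

theory Submission
  imports Defs "Jordan_Normal_Form.Determinant"
begin

text \<open>
  Multiplying a representative \<open>F\<close> of a rational map by a form \<open>h\<close> multiplies its Jacobian determinant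
  by \<open>h^(n+1)\<close>, up to a constant. For \<open>n\<close> odd this is a square, so the parity of the order of the
  Jacobian determinant along an arc \<open>x(t)\<close> with coordinates in \<open>k'[t]\<close>, \<open>k'\<close> an algebraic closure of
  \<open>k\<close>, is insensitive to such factors.
  By the chain rule \<open>J(F \<circ> G) = J(F)(G) \<cdot> J(G)\<close>, the maps having a representative for which the
  order is even on every arc (where it is finite) are closed under composition.
  For \<open>\<sigma>\<^sub>n\<close> the determinant is a constant times \<open>(x\<^sub>0 \<cdots> x\<^sub>n)^(n-1)\<close>; for an automorphism it does not
  vanish at the starting point of the arc if the representative is chosen well.
  For \<open>\<xi>\<^sub>n\<close> it is, up to a constant and factors \<open>h^(n+1)\<close>, equal to \<open>x\<^sub>0\<^sup>n x\<^sub>1\<close>, which has odd order on the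
  arc \<open>x\<^sub>i = t^(N^i)\<close> for \<open>N\<close> even.
\<close>

section \<open>Partial derivatives\<close>

text \<open>Substituting the indeterminates into \<open>p\<close> rewrites it as a sum of products
  of constants and indeterminates. Letting \<open>P\<close> depend on the degree is what Euler's
  relation requires.\<close>

lemma form_induct [consumes 1, case_names zero const indet add mult]:
  assumes "is_form n d p"
    and zero: "\<And>d. P d 0"
    and const: "\<And>c. P 0 (const_poly c)"
    and indet: "\<And>i. i \<le> n \<Longrightarrow> P 1 (indet i)"
    and add: "\<And>d p q. P d p \<Longrightarrow> P d q \<Longrightarrow> P d (p + q)"
    and mult: "\<And>d e p q. P d p \<Longrightarrow> P e q \<Longrightarrow> P (d + e) (p * q)"
  shows "P d p"
proof -
  have one: "P 0 1"
    using const[of 1] by simp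
  have power: "P (k * d) (p ^ k)" if "P d p" for k d p
    using that by (induction k) (auto intro: one mult)
  have prod: "P (\<Sum>i\<in>A. d i) (\<Prod>i\<in>A. f i)"
    if "\<And>i. i \<in> A \<Longrightarrow> P (d i) (f i)" for A :: "nat set" and d f
    using that by (induction A rule: infinite_finite_induct) (auto intro: one mult)
  have sum: "P d (\<Sum>i\<in>A. f i)"
    if "\<And>i. i \<in> A \<Longrightarrow> P d (f i)" for A :: "(nat \<Rightarrow>\<^sub>0 nat) set" and f
    using that by (induction A rule: infinite_finite_induct) (auto intro: zero add)
  have "P d (const_poly (Poly_Mapping.lookup p m) * eval_monom indet m)"
    if m: "m \<in> Poly_Mapping.keys p" for m
  proof -
    have "P (\<Sum>i\<in>Poly_Mapping.keys m. Poly_Mapping.lookup m i * 1) (eval_monom indet m)"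
      unfolding eval_monom_def
      using assms(1) m by (intro prod power indet) (auto simp: is_form_def)
    then show ?thesis
      using mult[OF const] assms(1) m by (fastforce simp: is_form_def)
  qed
  then have "P d (poly_subst indet p)"
    unfolding eval_poly_def by (rule sum)
  then show ?thesis by simp
qed

text \<open>The derivative is the linear coefficient of \<open>p(x + \<epsilon> e\<^sub>j)\<close>, so that the product rule is
  inherited from univariate polynomials.\<close>

definition shift_poly :: "nat \<Rightarrow> 'a::field mpoly \<Rightarrow> 'a mpoly poly" where
  "shift_poly j = eval_poly (\<lambda>c. [:const_poly c:]) (\<lambda>i. [:indet i, if i = j then 1 else 0:])"

definition mderiv :: "nat \<Rightarrow> 'a::field mpoly \<Rightarrow> 'a mpoly" where
  "mderiv j p = poly (pderiv (shift_poly j p)) 0"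

interpretation shift: ring_map "\<lambda>c::'a::field. [:const_poly c:] :: 'a mpoly poly"
  by standard (auto simp: one_pCons)

lemma poly_shift_poly: "poly (shift_poly j p) 0 = p"
proof -
  have "poly (shift_poly j p) 0 = poly_subst indet p"
    unfolding shift_poly_def eval_poly_def eval_monom_def
    by (simp add: poly_sum poly_prod del: sub_indet)
  then show ?thesis by simp
qed

lemma mderiv_add [simp]: "mderiv j (p + q) = mderiv j p + mderiv j q"
  by (simp add: mderiv_def shift_poly_def pderiv_add)

lemma mderiv_mult: "mderiv j (p * q) = mderiv j p * q + p * mderiv j q"
proof -
  have "shift_poly j (p * q) = shift_poly j p * shift_poly j q"
    by (simp add: shift_poly_def)
  then show ?thesis
    by (simp add: mderiv_def pderiv_mult poly_shift_poly)
qed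

lemma mderiv_zero [simp]: "mderiv j 0 = 0"
  by (simp add: mderiv_def shift_poly_def)

lemma mderiv_const [simp]: "mderiv j (const_poly c) = 0"
  unfolding mderiv_def shift_poly_def const_poly_def[of c] shift.eval_single
  by (simp add: pderiv_pCons)

lemma mderiv_indet [simp]: "mderiv j (indet i) = (if i = j then 1 else 0)"
  by (simp add: mderiv_def shift_poly_def pderiv_pCons)

text \<open>Both sides obey the same sum and product rules in \<open>p\<close>, so comparing them on
  generators suffices.\<close>

lemma mderiv_subst:
  assumes "is_form n d p"
  shows "mderiv j (poly_subst G p) = (\<Sum>k\<le>n. poly_subst G (mderiv k p) * mderiv j (G k))"
  using assms
proof (induction rule: form_induct)
  case (indet i)
  have "(\<Sum>k\<le>n. poly_subst G (mderiv k (indet i)) * mderiv j (G k)) =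
     (\<Sum>k\<le>n. if k = i then mderiv j (G k) else 0)"
    by (intro sum.cong) auto
  then show ?case using indet by simp
qed (simp_all add: mderiv_mult algebra_simps sum.distrib sum_distrib_left)

lemma form_mderiv:
  assumes "is_form n d p"
  shows "is_form n (d - 1) (mderiv j p)"
proof -
  \<comment> \<open>For a factor of degree 0 the truncated \<open>d - 1\<close> gives the wrong
    degree in the product rule; the last conjunct makes that summand vanish.\<close>
  have "is_form n d p \<and> is_form n (d - 1) (mderiv j p) \<and> (d = 0 \<longrightarrow> mderiv j p = 0)"
    using assms
  proof (induction rule: form_induct)
    case (mult d e p q)
    have "is_form n (d + e - 1) (mderiv j p * q)"
      using mult form_mult[of n "d - 1" "mderiv j p" e q] by (cases d) auto
    moreover have "is_form n (d + e - 1) (p * mderiv j q)"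
      using mult form_mult[of n d p "e - 1" "mderiv j q"] by (cases e) auto
    ultimately show ?case
      using mult by (auto simp: mderiv_mult intro: form_add form_mult)
  qed (auto intro: form_add form_indet simp del: One_nat_def)
  then show ?thesis by simp
qed

lemma euler:
  assumes "is_form n d p"
  shows "(\<Sum>j\<le>n. indet j * mderiv j p) = of_nat d * p"
  using assms
proof (induction rule: form_induct)
  case (indet i)
  have "(\<Sum>j\<le>n. indet j * mderiv j (indet i)) = (\<Sum>j\<le>n. if j = i then indet j else 0 :: 'a mpoly)"
    by (intro sum.cong) auto
  then show ?case using indet by simp
next
  case (mult d e p q)
  have "(\<Sum>j\<le>n. indet j * mderiv j (p * q)) =
      (\<Sum>j\<le>n. indet j * mderiv j p) * q + p * (\<Sum>j\<le>n. indet j * mderiv j q)"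
    by (simp add: mderiv_mult algebra_simps sum.distrib sum_distrib_left)
  then show ?case by (simp add: mult algebra_simps)
qed (simp_all add: algebra_simps sum.distrib)

section \<open>Jacobian determinants\<close>

definition jac :: "nat \<Rightarrow> (nat \<Rightarrow> 'a::field mpoly) \<Rightarrow> 'a mpoly" where
  "jac n F = det (mat (Suc n) (Suc n) (\<lambda>(i, j). mderiv j (F i)))"

text \<open>By Euler's relation, \<open>x\<^sub>0 jac F = deg F \<cdot> red_jac F\<close>. In positive characteristic \<open>jac F\<close> vanishes
  as soon as the characteristic divides the degree, whereas \<open>red_jac\<close> does not degenerate.\<close>

definition red_jac :: "nat \<Rightarrow> (nat \<Rightarrow> 'a::field mpoly) \<Rightarrow> 'a mpoly" where
  "red_jac n F = det (mat (Suc n) (Suc n) (\<lambda>(i, j). if j = 0 then F i else mderiv j (F i)))"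

lemma det_upper_mat:
  "(\<And>i j. j < i \<Longrightarrow> i < m \<Longrightarrow> f (i, j) = 0) \<Longrightarrow> det (mat m m f) = (\<Prod>i<m. f (i, i) :: 'a::idom)"
  by (subst det_upper_triangular[of _ m])
     (auto simp: prod_list_diag_prod lessThan_atLeast0 intro!: prod.cong)

lemma det_lower_mat:
  "(\<And>i j. i < j \<Longrightarrow> j < m \<Longrightarrow> f (i, j) = 0) \<Longrightarrow> det (mat m m f) = (\<Prod>i<m. f (i, i) :: 'a::idom)"
  by (subst det_lower_triangular[of m])
     (auto simp: prod_list_diag_prod lessThan_atLeast0 intro!: prod.cong)

lemma mult_mat_mat:
  "mat m m f * mat m m g = mat m m (\<lambda>(i, j). \<Sum>k<m. f (i, k) * g (k, j) :: 'a::comm_ring_1)"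
  by (rule eq_matI) (auto simp: scalar_prod_def lessThan_atLeast0)

lemma det_mat_mult:
  "det (mat m m f) * det (mat m m g) = det (mat m m (\<lambda>(i, j). \<Sum>k<m. f (i, k) * g (k, j) :: 'a::comm_ring_1))"
  by (subst det_mult[symmetric, of _ m]) (auto simp: mult_mat_mat)

lemma jac_subst:
  assumes F: "forms_of_degree n F d"
  shows "jac n (subst_tuple F G) = poly_subst G (jac n F) * jac n G"
proof -
  interpret comm_ring_hom "poly_subst G"
    by standard auto
  have "poly_subst G (jac n F) = det (mat (Suc n) (Suc n) (\<lambda>(i, j). poly_subst G (mderiv j (F i))))"
    unfolding jac_def hom_det[symmetric]
    by (rule arg_cong[where f = det], rule eq_matI) auto
  then have "poly_subst G (jac n F) * jac n G = det (mat (Suc n) (Suc n)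
     (\<lambda>(i, j). \<Sum>k<Suc n. poly_subst G (mderiv k (F i)) * mderiv j (G k)))"
    by (simp add: jac_def det_mat_mult)
  also have "\<dots> = jac n (subst_tuple F G)"
    unfolding jac_def
    by (rule arg_cong[where f = det], rule eq_matI)
       (auto simp: subst_tuple_def mderiv_subst[OF F[rule_format]] lessThan_Suc_atMost less_Suc_eq_le)
  finally show ?thesis by simp
qed

text \<open>A column operation replaces column 0 of the Jacobian matrix by the combination with
  coefficients x_k, which Euler's relation turns into d F. A diagonal matrix supplies the factor d,
  so nothing is divided by d.\<close>

lemma euler_jac:
  assumes F: "forms_of_degree n F d"
  shows "indet 0 * jac n F = of_nat d * red_jac n F"
proof -
  have "det (mat (Suc n) (Suc n) (\<lambda>(i, j). if j = 0 then indet i else if i = j then 1 else 0)) = (indet 0 :: 'a mpoly)"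
    by (subst det_lower_mat) (auto simp: prod.lessThan_Suc_shift simp del: prod.lessThan_Suc)
  then have E: "jac n F * indet 0 = det (mat (Suc n) (Suc n)
     (\<lambda>(i, j). \<Sum>k<Suc n. mderiv k (F i) * (if j = 0 then indet k else if k = j then 1 else 0)))"
    unfolding jac_def using det_mat_mult[of "Suc n" "\<lambda>(i, j). mderiv j (F i)" "\<lambda>(i, j). if j = 0 then indet i else if i = j then 1 else 0"] by simp
  have "det (mat (Suc n) (Suc n) (\<lambda>(i, j). if i = j then if j = 0 then of_nat d else 1 else 0)) = (of_nat d :: 'a mpoly)"
    by (subst det_lower_mat) (auto simp: prod.lessThan_Suc_shift simp del: prod.lessThan_Suc)
  then have R: "red_jac n F * of_nat d = det (mat (Suc n) (Suc n)
     (\<lambda>(i, j). \<Sum>k<Suc n. (if k = 0 then F i else mderiv k (F i)) * (if k = j then if j = 0 then of_nat d else 1 else 0)))"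
    unfolding red_jac_def using det_mat_mult[of "Suc n" "\<lambda>(i, j). if j = 0 then F i else mderiv j (F i)" "\<lambda>(i, j). if i = j then if j = 0 then of_nat d else 1 else 0"] by simp
  have sum_delta: "(\<Sum>k<Suc n. f k * (if k = j then c else 0)) = f j * c" if "j < Suc n" for f :: "nat \<Rightarrow> 'a mpoly" and j c
    using that by (subst sum.remove[of _ j]) auto
  have "jac n F * indet 0 = red_jac n F * of_nat d"
    unfolding E R
  proof (rule arg_cong[where f = det], rule eq_matI, goal_cases)
    case (1 i j)
    then have i: "i \<le> n" by simp
    show ?case
    proof (cases "j = 0")
      case True
      have "(\<Sum>k\<le>n. mderiv k (F i) * indet k) = of_nat d * F i"
        using euler[OF F[rule_format, OF i]] by (simp add: mult.commute)
      then show ?thesis using 1 True sum_delta[of 0 "\<lambda>k. if k = 0 then F i else mderiv k (F i)"]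
        by (simp add: lessThan_Suc_atMost mult.commute)
    next
      case False
      then show ?thesis using 1 by (simp add: sum_delta del: sum.lessThan_Suc)
    qed
  qed auto
  then show ?thesis by (simp add: mult.commute)
qed

text \<open>By the product rule, column j > 0 becomes h times itself plus \<open>mderiv j h\<close>
  times column 0: right multiplication by the triangular \<open>?B\<close>.\<close>

lemma red_jac_scale: "red_jac n (\<lambda>i. h * F i) = h ^ Suc n * red_jac n F"
proof -
  let ?B = "\<lambda>(i, j). if i = j then h else if i = 0 then mderiv j h else 0"
  have "det (mat (Suc n) (Suc n) ?B) = (\<Prod>i<Suc n. h)"
    by (subst det_upper_mat) auto
  then have "red_jac n F * h ^ Suc n = det (mat (Suc n) (Suc n)
     (\<lambda>(i, j). \<Sum>k<Suc n. (if k = 0 then F i else mderiv k (F i)) * ?B (k, j)))"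
    unfolding red_jac_def using det_mat_mult[of "Suc n" "\<lambda>(i, j). if j = 0 then F i else mderiv j (F i)" ?B]
    by simp
  also have "\<dots> = red_jac n (\<lambda>i. h * F i)"
    unfolding red_jac_def
  proof (rule arg_cong[where f = det], rule eq_matI, goal_cases)
    case (1 i j)
    have "(\<Sum>k<Suc n. (if k = 0 then F i else mderiv k (F i)) * ?B (k, j)) =
       F i * ?B (0, j) + (\<Sum>k<n. mderiv (Suc k) (F i) * ?B (Suc k, j))"
      unfolding sum.lessThan_Suc_shift by simp
    also have "(\<Sum>k<n. mderiv (Suc k) (F i) * ?B (Suc k, j)) = (\<Sum>k<n. if Suc k = j then mderiv j (F i) * h else 0)"
      by (intro sum.cong) auto
    also have "\<dots> = (if j = 0 then 0 else mderiv j (F i) * h)"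
      using 1 by (cases j) auto
    finally show ?case using 1 by (auto simp: mderiv_mult mult.commute)
  qed auto
  finally show ?thesis by (simp add: mult.commute)
qed

lemma jac_indet: "jac n indet = 1"
  unfolding jac_def by (subst det_lower_mat) auto

lemma red_jac_cong: "(\<And>i. i \<le> n \<Longrightarrow> F i = G i) \<Longrightarrow> red_jac n F = red_jac n G"
  unfolding red_jac_def by (rule arg_cong[where f = det], rule eq_matI) auto

lemma jac_proportional:
  assumes FG: "(F, G) \<in> proportional n"
    and F: "forms_of_degree n F d" and G: "forms_of_degree n G e" and i: "i \<le> n"
  shows "of_nat e * G i ^ Suc n * jac n F = of_nat d * F i ^ Suc n * jac n G"
proof -
  have "red_jac n (\<lambda>j. G i * F j) = red_jac n (\<lambda>j. F i * G j)"
    using FG i by (intro red_jac_cong) (simp add: proportional_def mult.commute)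
  then have "G i ^ Suc n * red_jac n F = F i ^ Suc n * red_jac n G"
    by (simp only: red_jac_scale)
  \<comment> \<open>With both degrees as factors, \<open>euler_jac\<close> converts each
    \<open>red_jac\<close> into \<open>jac\<close> without division by an integer that may be zero
    in the field.\<close>
  then have "of_nat e * of_nat d * (G i ^ Suc n * red_jac n F) =
      of_nat e * of_nat d * (F i ^ Suc n * red_jac n G)"
    by (rule arg_cong)
  then have "of_nat e * G i ^ Suc n * (of_nat d * red_jac n F) =
      of_nat d * F i ^ Suc n * (of_nat e * red_jac n G)"
    by (simp only: mult_ac)
  then have "indet 0 * (of_nat e * G i ^ Suc n * jac n F) = indet 0 * (of_nat d * F i ^ Suc n * jac n G)"
    unfolding euler_jac[OF F, symmetric] euler_jac[OF G, symmetric] by (simp only: mult_ac)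
  then show ?thesis by simp
qed

lemma form_jac:
  assumes F: "forms_of_degree n F d"
  shows "is_form n (Suc n * (d - 1)) (jac n F)"
proof -
  have "is_form n (\<Sum>i\<in>{0..<Suc n}. d - 1) (\<Prod>i\<in>{0..<Suc n}. mderiv (p i) (F i))" for p
    using F by (intro form_prod form_mderiv) auto
  moreover have "is_form n 0 (of_int (sign p) :: 'a mpoly)" for p :: "nat \<Rightarrow> nat"
  proof -
    have "(of_int k :: 'a mpoly) = const_poly (of_int k)" for k
      by (simp add: const_poly_def)
    then show ?thesis by simp
  qed
  ultimately have "is_form n (0 + (\<Sum>i\<in>{0..<Suc n}. d - 1)) (of_int (sign p) * (\<Prod>i\<in>{0..<Suc n}. mderiv (p i) (F i)))" for p
    by (intro form_mult)
  then show ?thesis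
    unfolding jac_def det_def
    by (auto intro!: form_sum simp del: mult_Suc form_zero cong: prod.cong_simp)
qed

section \<open>Arcs\<close>

text \<open>Coefficients are extended to the algebraic closure so that arcs can start at any
  geometric point tested by \<open>regular_at\<close>.\<close>

definition arc_eval :: "(nat \<Rightarrow> 'a::field alg_closure poly) \<Rightarrow> 'a mpoly \<Rightarrow> 'a alg_closure poly" where
  "arc_eval = eval_poly (\<lambda>c. [:to_ac c:])"

interpretation arc: ring_map "\<lambda>c::'a::field. [:to_ac c:]"
  rewrites "eval_poly (\<lambda>c::'a. [:to_ac c:]) = arc_eval"
proof -
  show "ring_map (\<lambda>c::'a::field. [:to_ac c:])"
    by standard (auto simp: one_pCons)
qed (simp add: arc_eval_def)

interpretation ac: ring_map "to_ac :: 'a::field \<Rightarrow> 'a alg_closure"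
  by standard auto

lemma (in ring_map) eval_of_nat [simp]: "eval_poly \<phi> v (of_nat k) = of_nat k"
  by (induction k) auto

lemma (in ring_map) eval_scale:
  assumes "is_form n d p" "\<And>i. i \<le> n \<Longrightarrow> v i = s * w i"
  shows "eval_poly \<phi> v p = s ^ d * eval_poly \<phi> w p"
  using assms(1)
proof (induction rule: form_induct)
  case (const c)
  then show ?case by (simp add: const_poly_def)
qed (simp_all add: assms(2) algebra_simps power_add)

lemma (in ring_map) eval_subst:
  "eval_poly \<phi> v (poly_subst G p) = eval_poly \<phi> (\<lambda>i. eval_poly \<phi> v (G i)) p"
proof (induction p rule: mpoly_induct)
  case (add m c p)
  then show ?case by (simp add: eval_monom_def, simp add: const_poly_def)
qed simp

lemma poly_arc_eval_0: "poly (arc_eval x p) 0 = eval_poly to_ac (\<lambda>i. poly (x i) 0) p"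
  by (simp add: arc_eval_def eval_poly_def eval_monom_def poly_sum poly_prod)

lemma order_power: "p \<noteq> 0 \<Longrightarrow> order a (p ^ k) = k * order a (p :: 'a::idom poly)"
  by (induction k) (auto simp: order_mult)

lemma order_of_nat: "(of_nat k :: 'a::idom) \<noteq> 0 \<Longrightarrow> order a (of_nat k :: 'a poly) = 0"
  by (simp add: order_0I of_nat_poly)

text \<open>Take s = t^m with m the least order at 0 of a nonzero coordinate; a coordinate attaining
  m keeps a nonzero constant term. The zero arc gets s = 0.\<close>

lemma arc_normalize:
  fixes x :: "nat \<Rightarrow> 'a::field poly"
  obtains s y where "\<And>i. i \<le> n \<Longrightarrow> x i = s * y i" "\<exists>i\<le>n. poly (y i) 0 \<noteq> 0"
proof (cases "\<forall>i\<le>n. x i = 0")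
  case True
  then show thesis using that[of 0 "\<lambda>_. 1"] by auto
next
  case False
  define m where "m = Min ((\<lambda>i. order 0 (x i)) ` {i\<in>{..n}. x i \<noteq> 0})"
  have "m \<in> (\<lambda>i. order 0 (x i)) ` {i\<in>{..n}. x i \<noteq> 0}"
    unfolding m_def using False by (intro Min_in) auto
  then obtain k where k: "k \<le> n" "x k \<noteq> 0" "m = order 0 (x k)"
    by auto
  have "[:0, 1:] ^ m dvd x i" if "i \<le> n" for i
  proof (cases "x i = 0")
    case False
    then have "m \<le> order 0 (x i)"
      unfolding m_def using that by (intro Min_le) auto
    then show ?thesis using order_divides[of 0 m "x i"] by simp
  qed simp
  then have "\<forall>i. \<exists>z. i \<le> n \<longrightarrow> x i = [:0, 1:] ^ m * z" by (auto simp: dvd_def)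
  then obtain y where y: "\<And>i. i \<le> n \<Longrightarrow> x i = [:0, 1:] ^ m * y i" by metis
  have "poly (y k) 0 \<noteq> 0"
  proof
    assume "poly (y k) 0 = 0"
    then have "[:0, 1:] ^ Suc m dvd x k"
      unfolding y[OF k(1)] power_Suc2 by (intro mult_dvd_mono) (auto simp: poly_eq_0_iff_dvd)
    then show False using order_2[OF k(2), of 0] k(3) by simp
  qed
  then show thesis using that y k by blast
qed

section \<open>Kronecker substitution\<close>

lemma digits_unique:
  fixes a b :: "nat \<Rightarrow> nat"
  assumes "\<And>i. i \<le> n \<Longrightarrow> a i < N \<and> b i < N" "(\<Sum>i\<le>n. a i * N ^ i) = (\<Sum>i\<le>n. b i * N ^ i)" "i \<le> n"
  shows "a i = b i"
  using assms
proof (induction n arbitrary: a b i)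
  case (Suc n)
  have shift: "(\<Sum>i\<le>Suc n. c i * N ^ i) = c 0 + N * (\<Sum>i\<le>n. c (Suc i) * N ^ i)" for c
    by (subst sum.atMost_Suc_shift) (simp add: sum_distrib_left algebra_simps)
  have lt: "a 0 < N" "b 0 < N" using Suc.prems(1)[of 0] by auto
  have eq: "a 0 + N * (\<Sum>i\<le>n. a (Suc i) * N ^ i) = b 0 + N * (\<Sum>i\<le>n. b (Suc i) * N ^ i)"
    using Suc.prems(2) unfolding shift .
  have 0: "a 0 = b 0" using arg_cong[OF eq, of "\<lambda>c. c mod N"] lt by simp
  then have "(\<Sum>i\<le>n. a (Suc i) * N ^ i) = (\<Sum>i\<le>n. b (Suc i) * N ^ i)"
    using eq lt by simp
  then have "a (Suc j) = b (Suc j)" if "j \<le> n" for j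
    using Suc.IH[of "\<lambda>i. a (Suc i)" "\<lambda>i. b (Suc i)" j] Suc.prems(1) that by auto
  then show ?case using 0 Suc.prems(3) by (cases i) auto
qed simp

lemma eval_monom_kronecker:
  assumes "Poly_Mapping.keys m \<subseteq> {..n}"
  shows "eval_monom (\<lambda>i. Polynomial.monom 1 (N ^ i)) m =
     (Polynomial.monom 1 (\<Sum>i\<le>n. Poly_Mapping.lookup m i * N ^ i) :: 'a::comm_ring_1 poly)"
proof -
  have "(\<Prod>i\<in>A. Polynomial.monom 1 (f i)) = (Polynomial.monom 1 (sum f A) :: 'a poly)" if "finite A" for A :: "nat set" and f
    using that by (induction A rule: finite_induct) (auto simp: mult_monom one_pCons monom_0)
  then show ?thesis
    using assms by (subst eval_monom_superset[of "{..n}"]) (auto simp: monom_power mult.commute)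
qed

text \<open>Kronecker substitution: distinct monomials restrict to distinct powers of \<open>t\<close> on the arc
  \<open>x\<^sub>i = t^(N^i)\<close>.\<close>

lemma kronecker_nonzero:
  assumes p: "is_form n d p" "p \<noteq> 0" and N: "d < N"
  shows "arc_eval (\<lambda>i. Polynomial.monom 1 (N ^ i)) p \<noteq> 0"
proof -
  \<comment> \<open>The number with the exponents of \<open>m\<close> as base-N digits; d < N makes
    it determine \<open>m\<close>, so no two terms of \<open>p\<close> can cancel.\<close>
  let ?w = "\<lambda>m. \<Sum>i\<le>n. Poly_Mapping.lookup m i * N ^ i"
  have digit: "Poly_Mapping.lookup m i < N" if "m \<in> Poly_Mapping.keys p" "i \<le> n" for m i
  proof -
    have "Poly_Mapping.lookup m i \<le> (\<Sum>i\<le>n. Poly_Mapping.lookup m i)"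
      using that by (intro member_le_sum) auto
    then show ?thesis using p(1) N that by (auto simp: is_form_deg)
  qed
  have inj: "m = m'" if m: "m \<in> Poly_Mapping.keys p" "m' \<in> Poly_Mapping.keys p" "?w m = ?w m'" for m m'
  proof (rule poly_mapping_eqI)
    fix i
    show "Poly_Mapping.lookup m i = Poly_Mapping.lookup m' i"
    proof (cases "i \<le> n")
      case True
      then show ?thesis
        using digits_unique[of n "Poly_Mapping.lookup m" N "Poly_Mapping.lookup m'" i] digit m by auto
    next
      case False
      then have "i \<notin> Poly_Mapping.keys m" "i \<notin> Poly_Mapping.keys m'"
        using p(1) m by (auto simp: is_form_deg)
      then show ?thesis by (simp add: in_keys_iff)
    qed
  qed
  obtain m0 where m0: "m0 \<in> Poly_Mapping.keys p" using p(2) by fastforce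
  have "coeff (arc_eval (\<lambda>i. Polynomial.monom 1 (N ^ i)) p) (?w m0) =
     (\<Sum>m\<in>Poly_Mapping.keys p. if m = m0 then to_ac (Poly_Mapping.lookup p m) else 0)"
    unfolding arc_eval_def eval_poly_def coeff_sum
  proof (rule sum.cong)
    fix m assume m: "m \<in> Poly_Mapping.keys p"
    have "Poly_Mapping.keys m \<subseteq> {..n}" using p(1) m by (auto simp: is_form_deg)
    then show "coeff ([:to_ac (Poly_Mapping.lookup p m):] * eval_monom (\<lambda>i. Polynomial.monom 1 (N ^ i)) m) (?w m0)
       = (if m = m0 then to_ac (Poly_Mapping.lookup p m) else 0)"
      using inj[OF m m0] by (auto simp: eval_monom_kronecker)
  qed simp
  also have "\<dots> = to_ac (Poly_Mapping.lookup p m0)" using m0 by simp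
  also have "\<dots> \<noteq> 0" using m0 by (simp add: in_keys_iff)
  finally show ?thesis by auto
qed

section \<open>The parity invariant\<close>

definition even_jac :: "nat \<Rightarrow> (nat \<Rightarrow> 'a::field mpoly) \<Rightarrow> bool" where
  "even_jac n F \<longleftrightarrow> (\<forall>x. arc_eval x (jac n F) \<noteq> 0 \<longrightarrow> even (order 0 (arc_eval x (jac n F))))"

text \<open>The condition on the degree excludes representatives whose Jacobian determinant vanishes
  for the trivial reason that the characteristic divides the degree.\<close>

definition even_map :: "nat \<Rightarrow> 'a::field rat_map \<Rightarrow> bool" where
  "even_map n f \<longleftrightarrow> (\<exists>F d. F \<in> f \<and> forms_of_degree n F d \<and> (of_nat d :: 'a) \<noteq> 0 \<and> even_jac n F)"

lemma dominant_proportional: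
  assumes F: "dominant n F" and FG: "(F, G) \<in> proportional n"
  shows "dominant n G"
  unfolding dominant_def
proof (intro conjI allI impI)
  show "form_tuple n G" using FG by (simp add: proportional_def)
  fix d p assume p: "is_form n d p" "poly_subst G p = 0"
  obtain i where i: "i \<le> n" "G i \<noteq> 0" using FG by (auto simp: proportional_def form_tuple_def)
  have "G i ^ d * poly_subst F p = 0" using proportional_sub[OF FG p(1) i(1)] p(2) by simp
  then show "p = 0" using i F p(1) by (auto simp: dominant_def)
qed

lemma Bir_rep:
  assumes "f \<in> carrier (Bir n)" "F \<in> f"
  shows "dominant n F" "f = rat_class n F"
proof -
  obtain F' where F': "dominant n F'" "f = rat_class n F'" using BirE assms(1) by blast
  then have "(F', F) \<in> proportional n" using assms(2) by (simp add: in_rat_class)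
  then show "dominant n F" "f = rat_class n F"
    using dominant_proportional F' rat_class_eqI by blast+
qed

text \<open>J(F)(G) along x is J(F) along the arc G(x), which is why \<open>even_jac\<close>
  quantifies over all arcs.\<close>

lemma even_map_comp:
  fixes f g :: "'a::field rat_map"
  assumes f: "f \<in> carrier (Bir n)" "even_map n f" and g: "g \<in> carrier (Bir n)" "even_map n g"
  shows "even_map n (rat_comp n f g)"
proof -
  obtain F d where F: "F \<in> f" "forms_of_degree n F d" "(of_nat d :: 'a) \<noteq> 0" "even_jac n F"
    using f(2) by (auto simp: even_map_def)
  obtain G e where G: "G \<in> g" "forms_of_degree n G e" "(of_nat e :: 'a) \<noteq> 0" "even_jac n G"
    using g(2) by (auto simp: even_map_def)
  note F' = Bir_rep[OF f(1) F(1)] and G' = Bir_rep[OF g(1) G(1)]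
  have "subst_tuple F G \<in> rat_comp n f g"
    unfolding F'(2) G'(2) comp_dominant[OF F'(1) G'(1)]
    using dominant_subst(2)[OF F'(1) G'(1)] by (intro rat_class_self) (simp add: dominant_def)
  moreover have "forms_of_degree n (subst_tuple F G) (d * e)"
    using F(2) G(2) by (auto simp: subst_tuple_def intro: form_sub)
  moreover have "even_jac n (subst_tuple F G)"
    using F(4) G(4) unfolding even_jac_def jac_subst[OF F(2)]
    by (auto simp: order_mult arc.eval_subst)
  ultimately show ?thesis
    unfolding even_map_def using F(3) G(3) by (metis mult_eq_0_iff of_nat_mult)
qed

lemma even_map_id: "even_map n (rat_class n indet)"
proof -
  have "indet \<in> rat_class n (indet :: nat \<Rightarrow> 'a mpoly)"
    by (intro rat_class_self) simp
  moreover have "forms_of_degree n (indet :: nat \<Rightarrow> 'a mpoly) 1"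
    using form_indet by blast
  ultimately show ?thesis
    unfolding even_map_def even_jac_def
    by (intro exI[of _ indet] exI[of _ 1]) (auto simp: jac_indet)
qed

text \<open>If d is zero in the field, then d + 1 is not. The choice of \<open>i\<close> is left
  free to preserve regularity at a given point.\<close>

lemma adjust_degree:
  fixes f :: "'a::field rat_map"
  assumes f: "f \<in> rat_maps n" and F: "F \<in> f" and i: "i \<le> n"
  obtains h e where "h = 1 \<or> h = indet i" "(\<lambda>j. h * F j) \<in> f" "forms_of_degree n (\<lambda>j. h * F j) e" "(of_nat e :: 'a) \<noteq> 0"
proof -
  note F' = rat_mapsE[OF f F]
  then obtain d where d: "forms_of_degree n F d" by (auto simp: form_tuple_def)
  have 1: "forms_of_degree n (\<lambda>j. indet i * F j) (Suc d)"
    using form_mult[OF form_indet[OF i], of d] d by (metis plus_1_eq_Suc)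
  have "form_tuple n (\<lambda>j. indet i * F j)"
    using 1 F'(2) unfolding form_tuple_def by (metis mult_eq_0_iff indet_nonzero)
  then have "(F, \<lambda>j. indet i * F j) \<in> proportional n"
    using F'(2) by (simp add: proportional_def mult_ac)
  then have 2: "(\<lambda>j. indet i * F j) \<in> f" unfolding F'(1) by (simp add: in_rat_class)
  show thesis
  proof (cases "(of_nat d :: 'a) = 0")
    case True
    then show ?thesis using that[of "indet i" "Suc d"] 1 2 by simp
  next
    case False
    then show ?thesis using that[of 1 d] d F by simp
  qed
qed

section \<open>The standard involution\<close>

text \<open>Since \<open>x\<^sub>i \<sigma>\<^sub>i = P = x\<^sub>0 \<cdots> x\<^sub>n\<close>, multiplying row \<open>i\<close> of the matrix \<open>M\<close> of \<open>red_jac\<close> by \<open>x\<^sub>i\<close> gives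
  \<open>P\<close> in column \<open>0\<close> and \<open>\<partial>\<^sub>j P - \<delta>\<^sub>i\<^sub>j \<sigma>\<^sub>i\<close> in column \<open>j > 0\<close>, which is a product of triangular matrices.\<close>

lemma red_jac_sigma: "red_jac n (sigma_tuple n) = (\<Prod>i<n. - sigma_tuple n (Suc i) :: 'a::field mpoly)"
proof -
  let ?s = "sigma_tuple n :: nat \<Rightarrow> 'a mpoly"
  define P where "P = (\<Prod>j\<le>n. indet j :: 'a mpoly)"
  have P0: "P \<noteq> 0" by (simp add: P_def prod_zero_iff)
  let ?D = "\<lambda>(i, j). if i = j then indet i else 0 :: 'a mpoly"
  let ?M = "\<lambda>(i, j). if j = 0 then ?s i else mderiv j (?s i)"
  let ?T = "\<lambda>(i, j). if j = 0 then 1 else if i = j then - ?s i else 0"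
  let ?S = "\<lambda>(i, j). if i = j then (if i = 0 then P else 1) else if i = 0 then mderiv j P else 0"
  have "(\<Sum>k<Suc n. ?D (i, k) * ?M (k, j)) = (\<Sum>k<Suc n. ?T (i, k) * ?S (k, j))"
    if ij: "i < Suc n" "j < Suc n" for i j
  proof -
    have s: "?s i * indet i = P" using sigma_tuple_mult[of i n] ij by (simp add: P_def)
    have "(\<Sum>k<Suc n. ?D (i, k) * ?M (k, j)) = (\<Sum>k<Suc n. if k = i then indet i * ?M (i, j) else 0)"
      by (intro sum.cong) auto
    also have "\<dots> = indet i * ?M (i, j)"
      using ij by simp
    also have "\<dots> = ?S (0, j) + (if j = 0 then 0 else ?T (i, j))"
      unfolding s[symmetric] by (auto simp: mderiv_mult algebra_simps)
    also have "(if j = 0 then 0 else ?T (i, j)) = (\<Sum>k<n. if Suc k = j then ?T (i, j) else 0)"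
      using ij by (cases j) auto
    also have "\<dots> = (\<Sum>k<n. ?T (i, Suc k) * ?S (Suc k, j))"
      by (intro sum.cong) auto
    also have "?S (0, j) + \<dots> = (\<Sum>k<Suc n. ?T (i, k) * ?S (k, j))"
      unfolding sum.lessThan_Suc_shift by simp
    finally show ?thesis .
  qed
  then have "det (mat (Suc n) (Suc n) ?D) * det (mat (Suc n) (Suc n) ?M) =
      det (mat (Suc n) (Suc n) ?T) * det (mat (Suc n) (Suc n) ?S)"
    unfolding det_mat_mult by (intro arg_cong[where f = det] eq_matI) auto
  moreover have "det (mat (Suc n) (Suc n) ?D) = P"
    by (subst det_lower_mat) (auto simp: P_def lessThan_Suc_atMost)
  moreover have "det (mat (Suc n) (Suc n) ?S) = P"
    by (subst det_upper_mat) (auto simp: prod.lessThan_Suc_shift simp del: prod.lessThan_Suc)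
  moreover have "det (mat (Suc n) (Suc n) ?T) = (\<Prod>i<n. - ?s (Suc i))"
    by (subst det_lower_mat) (auto simp: prod.lessThan_Suc_shift simp del: prod.lessThan_Suc)
  ultimately show ?thesis using P0 by (simp add: red_jac_def mult.commute)
qed

text \<open>With P = x_0...x_n, the entries of \<open>sigma_tuple\<close> multiply to P^n, so entry
  0 completes \<open>red_jac\<close> to a power of P up to sign. That entry times x_0 is P, so
  \<open>euler_jac\<close> applies to P times \<open>jac\<close>, and P cancels.\<close>

lemma jac_sigma:
  fixes h :: "'a::field mpoly"
  assumes F: "forms_of_degree (Suc m) (\<lambda>i. h * sigma_tuple (Suc m) i) d"
  shows "jac (Suc m) (\<lambda>i. h * sigma_tuple (Suc m) i) =
    of_nat d * h ^ (m + 2) * (-1) ^ Suc m * (\<Prod>j\<le>Suc m. indet j) ^ m"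
proof -
  let ?n = "Suc m"
  let ?s = "sigma_tuple ?n :: nat \<Rightarrow> 'a mpoly"
  define P where "P = (\<Prod>j\<le>?n. indet j :: 'a mpoly)"
  have P0: "P \<noteq> 0" by (simp add: P_def prod_zero_iff)
  have "(\<Prod>i\<le>?n. ?s i) * P = (\<Prod>i\<le>?n. P)"
    unfolding P_def prod.distrib[symmetric] by (intro prod.cong) (auto simp: sigma_tuple_mult)
  then have "(\<Prod>i\<le>?n. ?s i) = P ^ ?n" using P0 by simp
  moreover have "(\<Prod>i\<le>?n. ?s i) = ?s 0 * (\<Prod>i<?n. ?s (Suc i))"
    unfolding lessThan_Suc_atMost[symmetric] by (rule prod.lessThan_Suc_shift)
  moreover have "red_jac ?n ?s = (-1) ^ ?n * (\<Prod>i<?n. ?s (Suc i))"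
    unfolding red_jac_sigma prod_uminus by simp
  ultimately have red: "?s 0 * red_jac ?n ?s = (-1) ^ ?n * P ^ ?n"
    by (metis mult.left_commute)
  have s0: "?s 0 * indet 0 = P" unfolding P_def by (rule sigma_tuple_mult) simp
  have "P * jac ?n (\<lambda>i. h * ?s i) = ?s 0 * (indet 0 * jac ?n (\<lambda>i. h * ?s i))"
    using s0 by (simp add: mult.assoc flip: s0)
  also have "\<dots> = of_nat d * h ^ Suc ?n * (?s 0 * red_jac ?n ?s)"
    unfolding euler_jac[OF F] red_jac_scale by (simp only: mult_ac)
  also have "\<dots> = P * (of_nat d * h ^ (m + 2) * (-1) ^ Suc m * P ^ m)"
    unfolding red by (simp add: mult_ac)
  finally have "jac ?n (\<lambda>i. h * ?s i) = of_nat d * h ^ (m + 2) * (-1) ^ Suc m * P ^ m"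
    using P0 mult_left_cancel by blast
  then show ?thesis unfolding P_def .
qed

lemma even_map_sigma:
  assumes "odd n"
  shows "even_map n (sigma n :: 'a::field rat_map)"
proof -
  obtain m where m: "n = Suc m" "even m" using assms by (cases n) auto
  have "sigma n \<in> rat_maps n" "sigma_tuple n \<in> (sigma n :: 'a rat_map)"
    unfolding sigma_def by (intro rat_class_in rat_class_self sigma_tuple_form)+
  then obtain h d where h: "(\<lambda>j. h * sigma_tuple n j) \<in> (sigma n :: 'a rat_map)"
    "forms_of_degree n (\<lambda>j. h * sigma_tuple n j) d" "(of_nat d :: 'a) \<noteq> 0"
    using adjust_degree[of "sigma n" n "sigma_tuple n" 0] by blast
  have "even_jac n (\<lambda>j. h * sigma_tuple n j)"
    unfolding even_jac_def
  proof (intro allI impI)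
    fix x :: "nat \<Rightarrow> 'a alg_closure poly"
    assume nz: "arc_eval x (jac n (\<lambda>j. h * sigma_tuple n j)) \<noteq> 0"
    have m1: "(-1 :: 'a mpoly) ^ Suc m = const_poly (-1)"
      using m by (simp add: const_poly_def single_uminus)
    have c: "arc_eval x (const_poly (-1)) = [:-1:]"
      unfolding const_poly_def arc.eval_single by simp
    have d: "(of_nat d :: 'a alg_closure) \<noteq> 0"
      using h(3) by (metis to_ac_eq_0_iff to_ac_of_nat)
    show "even (order 0 (arc_eval x (jac n (\<lambda>j. h * sigma_tuple n j))))"
      using nz m unfolding m(1) jac_sigma[OF h(2)[unfolded m(1)]] m1
      by (auto simp: order_mult order_power order_of_nat[OF d] c order_0I
          simp del: prod.atMost_Suc arc.eval_prod)
  qed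
  then show ?thesis unfolding even_map_def using h by blast
qed

text \<open>Covers the inverses of generators that \<open>generate\<close> adjoins.\<close>

lemma inv_sigma: "inv\<^bsub>Bir n\<^esub> (sigma n) = (sigma n :: 'a::field rat_map)"
proof -
  let ?s = "sigma_tuple n :: nat \<Rightarrow> 'a mpoly"
  let ?ss = "subst_tuple ?s ?s"
  have nz: "?s i \<noteq> 0" if "i \<le> n" for i by (simp add: sigma_tuple_def prod_zero_iff)
  have dom: "dominant n ?s"
    by (rule Bir_rep(1)[OF sigma_in_Bir]) (simp add: sigma_def rat_class_self sigma_tuple_form)
  have m: "?ss i * ?s i = (\<Prod>j\<le>n. ?s j)" if "i \<le> n" for i
    using arg_cong[OF sigma_tuple_mult[OF that], of "poly_subst ?s"] by (simp add: subst_tuple_def)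
  have "?ss i * indet j = ?ss j * indet i" if ij: "i \<le> n" "j \<le> n" for i j
  proof -
    have "(?s i * ?s j) * (?ss i * indet j) = (?ss i * ?s i) * (?s j * indet j)" by simp
    also have "\<dots> = (?ss j * ?s j) * (?s i * indet i)" using ij by (simp add: m sigma_tuple_mult)
    also have "\<dots> = (?s i * ?s j) * (?ss j * indet i)" by simp
    finally show ?thesis using nz ij by simp
  qed
  then have "(?ss, indet) \<in> proportional n"
    using dominant_subst(2)[OF dom dom] by (simp add: proportional_def dominant_def)
  then have "rat_comp n (sigma n) (sigma n :: 'a rat_map) = rat_class n indet"
    unfolding sigma_def comp_dominant[OF dom dom] by (rule rat_class_eqI)
  then have "sigma n \<otimes>\<^bsub>Bir n\<^esub> sigma n = (\<one>\<^bsub>Bir n\<^esub> :: 'a rat_map)"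
    by (simp add: Bir_def)
  then show ?thesis
    by (rule group.inv_equality[OF Bir_group _ sigma_in_Bir sigma_in_Bir])
qed

section \<open>Automorphisms\<close>

text \<open>The degree is adjusted by a coordinate that does not vanish at p, so regularity there
  survives.\<close>

lemma regular_rep:
  fixes f :: "'a::field rat_map"
  assumes f: "f \<in> rat_maps n" "is_morphism n f" and p: "k \<le> n" "p k \<noteq> 0"
  obtains F d i where "F \<in> f" "forms_of_degree n F d" "(of_nat d :: 'a) \<noteq> 0" "i \<le> n" "eval_poly to_ac p (F i) \<noteq> 0"
proof -
  obtain F i where F: "F \<in> f" "i \<le> n" "eval_poly to_ac p (F i) \<noteq> 0"
    using f p unfolding is_morphism_def regular_at_def by blast
  obtain h d where h: "h = 1 \<or> h = indet k" "(\<lambda>j. h * F j) \<in> f" "forms_of_degree n (\<lambda>j. h * F j) d" "(of_nat d :: 'a) \<noteq> 0"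
    using adjust_degree[OF f(1) F(1) p(1)] by blast
  have "eval_poly to_ac p (h * F i) \<noteq> 0" using h(1) F(3) p(2) by auto
  then show thesis using that h F(2) by blast
qed

text \<open>Divide the arc by a power of \<open>t\<close> so that it starts at a point \<open>p\<close> of projective space. For
  representatives \<open>F'\<close> of \<open>f\<close> regular at \<open>p\<close> and \<open>G\<close> of the inverse regular at \<open>F' p\<close>, the composite
  \<open>G \<circ> F'\<close> represents the identity and does not vanish at \<open>p\<close>, so the chain rule makes
  \<open>jac F'\<close> nonzero at \<open>p\<close>; passing from \<open>F'\<close> to \<open>F\<close> changes the order by a multiple of \<open>n + 1\<close>.\<close>

lemma even_map_Aut:
  fixes f :: "'a::field rat_map"
  assumes n: "odd n" and f: "f \<in> Aut_P n"
  shows "even_map n f"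
proof -
  define g where "g = inv\<^bsub>Bir n\<^esub> f"
  have fB: "f \<in> carrier (Bir n)" and morph: "is_morphism n f" "is_morphism n g"
    using f by (auto simp: Aut_P_def g_def)
  have gB: "g \<in> carrier (Bir n)"
    unfolding g_def by (rule group.inv_closed[OF Bir_group fB])
  have gf: "rat_comp n g f = rat_class n indet"
    using group.l_inv[OF Bir_group fB] by (simp add: g_def Bir_def)
  have maps: "f \<in> rat_maps n" "g \<in> rat_maps n" using fB gB by (auto simp: Bir_def)
  obtain F0 where F0: "F0 \<in> f" using rat_maps_nonempty maps by blast
  obtain F d where F: "F \<in> f" "forms_of_degree n F d" "(of_nat d :: 'a) \<noteq> 0"
    using adjust_degree[OF maps(1) F0 le0] by blast
  have "even (order 0 (arc_eval x (jac n F)))" if x: "arc_eval x (jac n F) \<noteq> 0" for x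
  proof -
    obtain s y k where y: "\<And>i. i \<le> n \<Longrightarrow> x i = s * y i" "k \<le> n" "poly (y k) 0 \<noteq> 0"
      using arc_normalize by metis
    define p where "p i = poly (y i) 0" for i
    have eval_p: "poly (arc_eval y q) 0 = eval_poly to_ac p q" for q
      by (simp add: poly_arc_eval_0 p_def[abs_def])
    have xy: "arc_eval x (jac n F) = s ^ (Suc n * (d - 1)) * arc_eval y (jac n F)"
      by (rule arc.eval_scale[OF form_jac[OF F(2)] y(1)])
    obtain F' d' i where F': "F' \<in> f" "forms_of_degree n F' d'" "(of_nat d' :: 'a) \<noteq> 0" "i \<le> n"
      "eval_poly to_ac p (F' i) \<noteq> 0"
      using regular_rep[OF maps(1) morph(1) y(2), of p] y(3) by (auto simp: p_def)
    define q where "q i = eval_poly to_ac p (F' i)" for i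
    obtain G e l where G: "G \<in> g" "forms_of_degree n G e" "(of_nat e :: 'a) \<noteq> 0" "l \<le> n"
      "eval_poly to_ac q (G l) \<noteq> 0"
      using regular_rep[OF maps(2) morph(2) F'(4), of q] F'(5) by (auto simp: q_def)
    define H where "H = subst_tuple G F'"
    have Hl: "eval_poly to_ac p (H l) \<noteq> 0"
      using G(5) by (simp add: H_def subst_tuple_def ac.eval_subst q_def[abs_def])
    note dom = Bir_rep[OF gB G(1)] Bir_rep[OF fB F'(1)]
    have "rat_class n H = rat_class n indet"
      using gf dom(2,4) comp_dominant[OF dom(1,3)] by (simp add: H_def)
    then have Hid: "(H, indet) \<in> proportional n"
      using dominant_subst(2)[OF dom(1,3)] by (subst (asm) rat_class_eq) (auto simp: H_def dominant_def)
    have H: "forms_of_degree n H (e * d')"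
      using G(2) F'(2) by (auto simp: H_def subst_tuple_def intro: form_sub)
    have id: "forms_of_degree n (indet :: nat \<Rightarrow> 'a mpoly) 1"
      using form_indet by blast
    \<comment> \<open>Comparison of \<open>H\<close> with the identity, whose Jacobian is 1; the
      right side is nonzero at p because both degrees are nonzero in the field.\<close>
    have "eval_poly to_ac p (of_nat 1 * indet l ^ Suc n * jac n H) =
       eval_poly to_ac p (of_nat (e * d') * H l ^ Suc n * jac n indet)"
      using jac_proportional[OF Hid H id G(4)] by (rule arg_cong)
    moreover have "eval_poly to_ac p (of_nat (e * d') * H l ^ Suc n * jac n indet) \<noteq> 0"
      using Hl G(3) F'(3) by (simp add: jac_indet flip: to_ac_of_nat)
    ultimately have "eval_poly to_ac p (jac n H) \<noteq> 0" by auto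
    then have "eval_poly to_ac p (jac n F') \<noteq> 0"
      unfolding H_def jac_subst[OF G(2)] by simp
    then have ord_jac: "order 0 (arc_eval y (jac n F')) = 0" "arc_eval y (jac n F') \<noteq> 0"
      using eval_p[of "jac n F'"] by (auto simp: order_0I)
    have ord_F': "order 0 (arc_eval y (F' i)) = 0" "arc_eval y (F' i) \<noteq> 0"
      using F'(5) eval_p[of "F' i"] by (auto simp: order_0I)
    have FF': "(F, F') \<in> proportional n"
      using F'(1) Bir_rep(2)[OF fB F(1)] by (simp flip: in_rat_class)
    have of_nat_ac: "(of_nat d :: 'a alg_closure) \<noteq> 0" "(of_nat d' :: 'a alg_closure) \<noteq> 0"
      using F(3) F'(3) by (metis to_ac_eq_0_iff to_ac_of_nat)+
    then have of_nat_poly: "(of_nat d :: 'a alg_closure poly) \<noteq> 0" "(of_nat d' :: 'a alg_closure poly) \<noteq> 0"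
      by (simp_all add: of_nat_poly)
    have "arc_eval y (of_nat d' * F' i ^ Suc n * jac n F) = arc_eval y (of_nat d * F i ^ Suc n * jac n F')"
      using jac_proportional[OF FF' F(2) F'(2,4)] by (rule arg_cong)
    then have eq: "of_nat d' * arc_eval y (F' i) ^ Suc n * arc_eval y (jac n F) =
        of_nat d * arc_eval y (F i) ^ Suc n * arc_eval y (jac n F')"
      by (simp del: power_Suc)
    have yF: "arc_eval y (jac n F) \<noteq> 0" using x xy by auto
    then have Fi: "arc_eval y (F i) \<noteq> 0" using eq of_nat_poly ord_F'(2) by auto
    have "order 0 (arc_eval y (jac n F)) = Suc n * order 0 (arc_eval y (F i))"
      using arg_cong[OF eq, of "order 0"] yF Fi of_nat_poly ord_F' ord_jac
      by (simp add: order_mult order_power order_of_nat of_nat_ac del: power_Suc mult_Suc)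
    \<comment> \<open>The rescaling also contributes a multiple of n + 1. If d = 1 the power of
      \<open>s\<close> is 1, and \<open>s\<close> itself may be zero.\<close>
    moreover have "order 0 (arc_eval x (jac n F)) = Suc n * (d - 1) * order 0 s + order 0 (arc_eval y (jac n F))"
      using x unfolding xy by (cases "d - 1 = 0") (auto simp: order_mult order_power simp del: power_Suc mult_Suc)
    ultimately show ?thesis using n by simp
  qed
  then show ?thesis unfolding even_map_def even_jac_def using F by blast
qed

lemma inv_Aut:
  assumes "f \<in> Aut_P n"
  shows "inv\<^bsub>Bir n\<^esub> f \<in> Aut_P n"
proof -
  have f: "f \<in> carrier (Bir n)" using assms by (simp add: Aut_P_def)
  show ?thesis
    using assms group.inv_closed[OF Bir_group f] group.inv_inv[OF Bir_group f]
    by (simp add: Aut_P_def)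
qed

section \<open>Evenness on the generated group\<close>

lemma even_map_G_grp:
  assumes n: "odd n" and f: "f \<in> G_grp n"
  shows "even_map n (f :: 'a::field rat_map)"
proof -
  have sub: "insert (sigma n) (Aut_P n) \<subseteq> carrier (Bir n :: 'a rat_map monoid)"
    using sigma_in_Bir by (auto simp: Aut_P_def)
  from f[unfolded G_grp_def] have "even_map n f \<and> f \<in> carrier (Bir n)"
  proof (induction rule: generate.induct)
    case one
    have "\<one>\<^bsub>Bir n\<^esub> = (rat_class n indet :: 'a rat_map)" by (simp add: Bir_def)
    then show ?case by (simp add: even_map_id Bir_one)
  next
    case (incl h)
    then show ?case using even_map_sigma even_map_Aut n sub by auto
  next
    case (inv h)
    then show ?case
      using even_map_sigma even_map_Aut inv_Aut[of h n] n sub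
      by (auto simp: inv_sigma group.inv_closed[OF Bir_group])
  next
    case (eng h1 h2)
    then have "h1 \<otimes>\<^bsub>Bir n\<^esub> h2 \<in> carrier (Bir n)"
      using Bir_group by (meson group.is_monoid monoid.m_closed)
    then show ?case using eng even_map_comp by (auto simp: Bir_def)
  qed
  then show ?thesis by simp
qed

section \<open>The map \<open>\<xi>\<^sub>n\<close>\<close>

text \<open>The matrix is lower triangular: the only entry off the diagonal and outside column 0 is
  x_2, in row 2 and column 1.\<close>

lemma red_jac_xi:
  assumes "n \<ge> 2"
  shows "red_jac n xi_tuple = (indet 0 ^ Suc n * indet 1 :: 'a::field mpoly)"
proof -
  obtain k where k: "n = Suc (Suc k)" using assms by (metis Suc_le_D numeral_2_eq_2 Suc_le_mono)
  have "red_jac n xi_tuple =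
      (\<Prod>i<Suc n. if i = 0 then indet 0 * indet 0 else if i = 2 then indet 1 else indet 0 :: 'a mpoly)"
    unfolding red_jac_def
    by (subst det_lower_mat) (auto simp: xi_tuple_def mderiv_mult intro!: prod.cong)
  also have "\<dots> = indet 0 ^ Suc n * indet 1"
    unfolding k by (simp add: prod.lessThan_Suc_shift del: prod.lessThan_Suc)
  finally show ?thesis .
qed

lemma not_even_map_xi:
  assumes n: "n \<ge> 3" "odd n"
  shows "\<not> even_map n (xi n :: 'a::field rat_map)"
proof
  let ?X = "xi_tuple :: nat \<Rightarrow> 'a mpoly"
  assume "even_map n (xi n :: 'a rat_map)"
  then obtain F d where F: "F \<in> (xi n :: 'a rat_map)" "forms_of_degree n F d" "(of_nat d :: 'a) \<noteq> 0" "even_jac n F"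
    unfolding even_map_def by blast
  have XF: "?X i * F j = ?X j * F i" if "i \<le> n" "j \<le> n" for i j
    using F(1) that by (auto simp: xi_def in_rat_class proportional_def)
  have n2: "n \<ge> 2" using n(1) by simp
  have X0: "?X 0 = indet 0 ^ 2" by (simp add: xi_tuple_def power2_eq_square)
  have F0: "F 0 \<noteq> 0"
  proof
    assume "F 0 = 0"
    then have "F j = 0" if "j \<le> n" for j using XF[of 0 j] that by (simp add: X0)
    then show False using F(1) by (auto simp: xi_def in_rat_class proportional_def form_tuple_def)
  qed
  have "red_jac n (\<lambda>j. ?X 0 * F j) = red_jac n (\<lambda>j. F 0 * ?X j)"
    using XF by (intro red_jac_cong) (simp add: mult.commute)
  then have "?X 0 ^ Suc n * red_jac n F = F 0 ^ Suc n * (indet 0 ^ Suc n * indet 1)"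
    unfolding red_jac_scale red_jac_xi[OF n2] .
  then have "of_nat d * (?X 0 ^ Suc n * red_jac n F) = of_nat d * (F 0 ^ Suc n * (indet 0 ^ Suc n * indet 1))"
    by (rule arg_cong)
  then have eq: "(indet 0 ^ 2) ^ Suc n * (indet 0 * jac n F) = of_nat d * (F 0 ^ Suc n * (indet 0 ^ Suc n * indet 1))"
    unfolding euler_jac[OF F(2)] X0 by (simp only: mult.left_commute)
  \<comment> \<open>N > d keeps \<open>F 0\<close> nonzero on the arc, and N even gives x_1 even
    order, while x_0 = t has order 1.\<close>
  define N where "N = 2 * (d + 1)"
  define x :: "nat \<Rightarrow> 'a alg_closure poly" where "x i = Polynomial.monom 1 (N ^ i)" for i
  have x: "x i \<noteq> 0" "order 0 (x i) = N ^ i" for i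
    using order_0_monom[of "1 :: 'a alg_closure" "N ^ i"] by (auto simp: x_def)
  have xF: "arc_eval x (F 0) \<noteq> 0"
    unfolding x_def using kronecker_nonzero[OF _ F0, of n d N] F(2) by (simp add: N_def)
  have d: "(of_nat d :: 'a alg_closure) \<noteq> 0" "(of_nat d :: 'a alg_closure poly) \<noteq> 0"
    using F(3) by (simp_all add: of_nat_poly flip: to_ac_of_nat)
  have E: "(x 0 ^ 2) ^ Suc n * (x 0 * arc_eval x (jac n F)) =
      of_nat d * (arc_eval x (F 0) ^ Suc n * (x 0 ^ Suc n * x 1))"
    using arg_cong[OF eq, of "arc_eval x"] by (simp del: power_Suc)
  then have J: "arc_eval x (jac n F) \<noteq> 0" using x(1) xF d by auto
  have "even (order 0 (arc_eval x (jac n F)))"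
    using F(4) J by (simp add: even_jac_def)
  \<comment> \<open>The single factor x_0 from \<open>euler_jac\<close> makes the left side odd,
    whereas n + 1 and N make the right side even.\<close>
  then have "odd (Suc n * 2 + (1 + order 0 (arc_eval x (jac n F))))" by simp
  moreover have "Suc n * 2 + (1 + order 0 (arc_eval x (jac n F))) =
      Suc n * order 0 (arc_eval x (F 0)) + (Suc n + N)"
    using arg_cong[OF E, of "order 0"] J x xF d
    by (simp add: order_mult order_power order_of_nat del: power_Suc mult_Suc)
  moreover have "even (Suc n * order 0 (arc_eval x (F 0)) + (Suc n + N))"
    using n by (simp add: N_def)
  ultimately show False by metis
qed

theorem corollary3p9:
  fixes n :: nat
  assumes "n \<ge> 3" and "odd n"
  shows "(xi n :: 'k::field rat_map) \<notin> G_grp n"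
  using not_even_map_xi[OF assms] even_map_G_grp[OF assms(2)] by blast

end
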